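(* Let $d\ge 1$ and $n=4(2^d-1)$. Then $\dim_{\mathbb F_2}(QP_5)_n$ equals $45$ for $d=1$, $190$ for $d=2$, $480$ for $d=3$, $650$ for $d=4$, and $651$ for every $d\ge 5$.
   Context: $P_5=\mathbb F_2[x_1,\dots,x_5]$ with each $x_i$ of degree $1$, a module over the mod-2 Steenrod algebra $\mathcal A$; $\mathcal A^+$ is the augmentation ideal and $QP_5=P_5/\mathcal A^+P_5$. $(QP_5)_n$ is the degree-$n$ part of $QP_5$. *)

theory Defs
  imports Complex_Main "HOL-Library.Z2" "HOL-Library.Function_Algebras"
begin

text \<open>Monomials of P_5 = F_2[x_1,...,x_5] are exponent vectors a :: nat \<Rightarrow> nat supported
  on {0..<5} (variable x_(i+1) has exponent a i).  A polynomial over F_2 is a coefficient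
  function from monomials to bit (= F_2).\<close>

type_synonym mon = "nat \<Rightarrow> nat"
type_synonym poly = "mon \<Rightarrow> bit"

definition mons5 :: "nat \<Rightarrow> mon set" where
  "mons5 n = {a. (\<forall>i\<ge>5. a i = 0) \<and> (\<Sum>i<5. a i) = n}"

definition P5 :: "nat \<Rightarrow> poly set" where
  "P5 n = {f. \<forall>m. f m \<noteq> 0 \<longrightarrow> m \<in> mons5 n}"

text \<open>Steenrod square Sq^k on polynomials, via the Cartan formula on monomials:
  Sq^k(x^a) = sum over c with |c| = k of (prod_i binom(a_i, c_i)) x^(a+c).
  The coefficient of x^m in Sq^k(f) is therefore the sum over a \<le> m with |m - a| = k.\<close>
definition Sq :: "nat \<Rightarrow> poly \<Rightarrow> poly" where
  "Sq k f = (\<lambda>m. \<Sum>a\<in>{a. (\<forall>i. a i \<le> m i) \<and> (\<Sum>i<5. m i - a i) = k}.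
                    f a * of_nat (\<Prod>i<5. (a i) choose (m i - a i)))"

global_interpretation F2: Vector_Spaces.vector_space "\<lambda>(c::bit) (f::poly). (\<lambda>m. c * f m)"
  by unfold_locales (auto simp: fun_eq_iff algebra_simps)

text \<open>(A^+ P_5)_n: degree-n part of the image of the augmentation ideal, i.e. the
  F_2-span of all Sq^k g with k > 0 and g homogeneous of degree n - k.\<close>
definition hit5 :: "nat \<Rightarrow> poly set" where
  "hit5 n = F2.span {Sq k g | k g. 0 < k \<and> k \<le> n \<and> g \<in> P5 (n - k)}"

text \<open>dim_F2 (QP_5)_n = dim (P_5)_n - dim (A^+P_5)_n  (quotient of finite-dim spaces).\<close>
definition dimQP5 :: "nat \<Rightarrow> nat" where
  "dimQP5 n = F2.dim (P5 n) - F2.dim (hit5 n)"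

end

theory Submission
  imports Defs "HOL-Library.List_Lexorder"
begin

text \<open>Dually, \<open>dim (QP\<^sub>5)\<^sub>n\<close> is the dimension of the space \<open>K\<^sub>n\<close> of functionals on
  \<open>(P\<^sub>5)\<^sub>n\<close> that vanish on all hit polynomials. Let \<open>n = 4 + 2m\<close> be the degree for \<open>d \<ge> 2\<close>,
  where \<open>m\<close> is the degree for \<open>d - 1\<close>. A monomial whose number of odd exponents is not \<open>4\<close> is
  annihilated by \<open>K\<^sub>n\<close>, so an element \<open>\<phi>\<close> of \<open>K\<^sub>n\<close> amounts to five functionals
  \<open>\<theta>\<^sub>j(y) = \<phi>(X\<^sub>j y\<^sup>2)\<close>, where \<open>X\<^sub>j\<close> is the product of all variables except \<open>x\<^sub>j\<close>. The Steenrod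
  squares say exactly that all \<open>\<theta>\<^sub>j\<close> lie in \<open>K\<^sub>m\<close> and that the contraction \<open>\<Sum>\<^sub>j \<theta>\<^sub>j(x\<^sub>j v)\<close>
  vanishes for all \<open>v\<close>.

  Iterating \<open>s = d - 1\<close> times down to degree \<open>4\<close> gives tensors indexed by \<open>j\<^sub>1, \<dots>, j\<^sub>s\<close> with
  values in \<open>K\<^sub>4\<close>. The contraction conditions make them symmetric and invariant under
  \<open>jjk \<mapsto> jkk\<close>, so that they are families \<open>\<theta>\<^sub>S\<close> indexed by the nonempty sets \<open>S\<close> of at most \<open>s\<close>
  variables; what remains is that the contraction of the functionals \<open>\<theta>\<close> at \<open>S \<union> {j}\<close>, for
  \<open>j = 1, \<dots>, 5\<close>, vanishes for all \<open>S\<close> with \<open>|S| < s\<close>. This linear system is the same for all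
  \<open>s \<ge> 6\<close>, and its ranks for \<open>s = 1, \<dots>, 6\<close> are found by Gaussian elimination.\<close>

section \<open>Counting functionals over the field with two elements\<close>

text \<open>The special degrees enter through the monomials with two odd exponents. In degree
  \<open>deg (Suc d)\<close> such a monomial is x_i x_j y^2 with r = deg y satisfying r + 2 =
  2^(d+2) - 1, and the argument needs r + 2 not to be a sum of two powers of 2. This holds for d
  \<ge> 1 but fails in degree 4, where 3 = 1 + 2; hence the recursion stops there.

  Dimensions are handled as cardinalities: a space over the field with two elements has 2^dim
  elements, so spaces are compared by bijections whose linearity need not be tracked.

  The values are 70 N - rank, where 70 = (8 choose 4) counts the monomials of degree 4 and N the
  sets S: 350 - 160 = 190, 1050 - 570 = 480, 1750 - 1100 = 650, 2100 - 1449 = 651 and 2170 - 1519 =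
  651. The threshold s = 6 is the first at which the contraction condition at the full set of five
  variables occurs.\<close>

declare add_bit_eq_xor [simp del] mult_bit_eq_and [simp del]

lemma bit_double [simp]: "(b::bit) + b = 0"
  by (cases b) auto

lemma bit_add_eq_0 [simp]: "(a::bit) + b = 0 \<longleftrightarrow> a = b"
  by (cases a; cases b) auto

text \<open>Over the field with two elements a linear combination of basis vectors is a subset sum,
  so subsets of a basis correspond bijectively to vectors. This is the bridge between
  \<open>F2.dim\<close> and cardinalities.\<close>

lemma card_F2_subspace:
  assumes V: "F2.subspace V" and fin: "finite V"
  shows "card V = 2 ^ F2.dim V"
proof -
  obtain B where B: "B \<subseteq> V" "F2.independent B" "V \<subseteq> F2.span B" "card B = F2.dim V"
    using F2.basis_exists[of V] by auto
  have finB: "finite B"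
    using B(1) fin finite_subset by blast
  have spanB: "F2.span B = V"
    using B(1,3) V F2.span_minimal by blast
  let ?s = "\<lambda>X. \<Sum>v\<in>X. v"
  let ?u = "\<lambda>X v. if v \<in> X then 1 else (0::bit)"
  have sum_u: "?s X = (\<Sum>v\<in>B. (\<lambda>m. ?u X v * v m))" if "X \<subseteq> B" for X
  proof -
    have "(\<Sum>v\<in>B. (\<lambda>m. ?u X v * v m)) = (\<Sum>v\<in>B. if v \<in> X then v else 0)"
      by (rule sum.cong) (auto simp: fun_eq_iff)
    also have "\<dots> = sum (\<lambda>v. v) (B \<inter> X)"
      using finB by (simp add: sum.inter_restrict)
    finally show ?thesis
      using that by (simp add: Int_absorb1)
  qed
  have "inj_on ?s (Pow B)"
  proof (rule inj_onI)
    fix X Y assume XY: "X \<in> Pow B" "Y \<in> Pow B" "?s X = ?s Y"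
    then have X: "X \<subseteq> B" and Y: "Y \<subseteq> B"
      by auto
    have "(\<Sum>v\<in>B. (\<lambda>m. (?u X v + ?u Y v) * v m)) = ?s X + ?s Y"
      unfolding sum_u[OF X] sum_u[OF Y] sum.distrib[symmetric] by (rule sum.cong)
        (simp_all add: fun_eq_iff distrib_right)
    also have "\<dots> = 0"
      using XY(3) by (simp add: fun_eq_iff)
    finally have 0: "(\<Sum>v\<in>B. (\<lambda>m. (?u X v + ?u Y v) * v m)) = 0" .
    have "\<forall>v\<in>B. ?u X v + ?u Y v = 0"
      by (intro ballI F2.independentD[OF B(2) finB order_refl 0])
    then have "\<forall>v\<in>B. v \<in> X \<longleftrightarrow> v \<in> Y"
      by (metis bit_add_eq_0 zero_neq_one)
    then show "X = Y"
      using XY(1,2) by blast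
  qed
  moreover have "?s ` Pow B = V"
  proof (intro set_eqI iffI)
    fix f assume "f \<in> ?s ` Pow B"
    then show "f \<in> V"
      using B(1) by (auto intro!: F2.subspace_sum[OF V])
  next
    fix f assume "f \<in> V"
    then obtain u where u: "f = (\<Sum>v\<in>B. (\<lambda>m. u v * v m))"
      unfolding spanB[symmetric] F2.span_finite[OF finB] by (rule rangeE)
    have "f = ?s {v\<in>B. u v = 1}"
      unfolding u using sum_u[of "{v\<in>B. u v = 1}"]
      by (auto intro!: sum.cong simp: fun_eq_iff[of "\<lambda>m. u _ * _ m"])
    then show "f \<in> ?s ` Pow B"
      by blast
  qed
  ultimately have "card (Pow B) = card V"
    using card_image by fastforce
  then show ?thesis
    by (simp only: card_Pow[OF finB] B(4))
qed

section \<open>Annihilators counted by character sums\<close>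

definition supp_in :: "'a set \<Rightarrow> ('a \<Rightarrow> bit) set" where
  "supp_in M = {f. \<forall>m. f m \<noteq> 0 \<longrightarrow> m \<in> M}"

lemma bij_supp_in: "bij_betw (\<lambda>X m. if m \<in> X then 1 else 0) (Pow M) (supp_in M)"
proof (rule bij_betw_byWitness[where f' = "\<lambda>f. {m. f m = 1}"])
qed (auto simp: supp_in_def fun_eq_iff split: if_splits)

lemma finite_supp_in: "finite M \<Longrightarrow> finite (supp_in M)"
  using bij_betw_finite[OF bij_supp_in, of M] by simp

lemma card_supp_in: "finite M \<Longrightarrow> card (supp_in M) = 2 ^ card M"
  using bij_betw_same_card[OF bij_supp_in, of M] card_Pow[of M] by simp

text \<open>The nontrivial character of the additive group of the field, with integer values so that
  orthogonality relations can be summed.\<close>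

definition sign :: "bit \<Rightarrow> int" where
  "sign b = (if b = 0 then 1 else -1)"

lemma sign_add: "sign (a + b) = sign a * sign b"
  by (cases a; cases b) (auto simp: sign_def)

text \<open>Translation by \<open>a\<close> permutes \<open>A\<close> and reverses the sign of every
  summand, so the sum equals its own negative.\<close>

lemma sum_sign_eq_0:
  assumes "finite A" "a \<in> A" "sign (l a) = -1"
    and closed: "\<And>x. x \<in> A \<Longrightarrow> x + a \<in> A"
    and inv: "\<And>x. x + a + a = (x::'b::plus)"
    and add: "\<And>x. x \<in> A \<Longrightarrow> l (x + a) = l x + l a"
  shows "(\<Sum>x\<in>A. sign (l x)) = 0"
proof -
  have "(\<Sum>x\<in>A. sign (l x)) = (\<Sum>x\<in>A. sign (l (x + a)))"
    by (rule sum.reindex_bij_witness[where i = "\<lambda>x. x + a" and j = "\<lambda>x. x + a"])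
      (simp_all only: inv closed)
  also have "\<dots> = (\<Sum>x\<in>A. - sign (l x))"
  proof (rule sum.cong)
    fix x assume "x \<in> A"
    then have "sign (l (x + a)) = sign (l x) * sign (l a)"
      by (simp only: add sign_add)
    then show "sign (l (x + a)) = - sign (l x)"
      using assms(3) by simp
  qed simp
  finally show ?thesis
    unfolding sum_negf by linarith
qed

text \<open>The signs of all pairings of \<phi> with h are summed in both orders. For fixed \<phi>
  the inner sum is \<open>card H\<close> if \<phi> annihilates \<open>H\<close> and 0 otherwise; for
  fixed h it is \<open>card (supp_in M)\<close> if h = 0 and 0 otherwise, because the indicator of a
  point where h is nonzero pairs to 1 with h.\<close>

lemma card_annihilator:
  fixes H :: "('a \<Rightarrow> bit) set"
  assumes M: "finite M" and H: "H \<subseteq> supp_in M" "0 \<in> H"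
    and closed: "\<And>f g. f \<in> H \<Longrightarrow> g \<in> H \<Longrightarrow> f + g \<in> H"
  shows "card H * card {\<phi> \<in> supp_in M. \<forall>h\<in>H. (\<Sum>m\<in>M. \<phi> m * h m) = 0} = 2 ^ card M"
proof -
  let ?P = "supp_in M"
  let ?A = "{\<phi> \<in> ?P. \<forall>h\<in>H. (\<Sum>m\<in>M. \<phi> m * h m) = 0}"
  define p where "p \<phi> h = (\<Sum>m\<in>M. \<phi> m * h m)" for \<phi> h :: "'a \<Rightarrow> bit"
  have finP: "finite ?P" and finH: "finite H"
    using finite_supp_in[OF M] H(1) finite_subset by auto
  have plusP: "f + g \<in> ?P" if "f \<in> ?P" "g \<in> ?P" for f g
  proof -
    have "m \<in> M" if "(f + g) m \<noteq> 0" for m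
      using that \<open>f \<in> ?P\<close> \<open>g \<in> ?P\<close> by (cases "f m = 0") (auto simp: supp_in_def)
    then show ?thesis
      unfolding supp_in_def by blast
  qed
  have inv: "f + g + g = f" for f g :: "'a \<Rightarrow> bit"
    by (simp add: fun_eq_iff add.assoc)
  have "(\<Sum>\<phi>\<in>?P. \<Sum>h\<in>H. sign (p \<phi> h)) = (\<Sum>\<phi>\<in>?P. if \<phi> \<in> ?A then int (card H) else 0)"
  proof (rule sum.cong)
    fix \<phi> assume \<phi>: "\<phi> \<in> ?P"
    show "(\<Sum>h\<in>H. sign (p \<phi> h)) = (if \<phi> \<in> ?A then int (card H) else 0)"
    proof (cases "\<phi> \<in> ?A")
      case True
      then show ?thesis
        by (simp add: p_def sign_def)
    next
      case False
      then obtain h where "h \<in> H" "p \<phi> h \<noteq> 0"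
        using \<phi> by (auto simp: p_def)
      then show ?thesis
        using False
        by (subst sum_sign_eq_0[OF finH, where a = h])
          (auto simp: closed inv p_def sum.distrib distrib_left sign_def)
    qed
  qed simp
  then have 1: "(\<Sum>\<phi>\<in>?P. \<Sum>h\<in>H. sign (p \<phi> h)) = int (card ?A * card H)"
    using finP by (simp add: sum.If_cases Int_def conj_commute)
  have "(\<Sum>h\<in>H. \<Sum>\<phi>\<in>?P. sign (p \<phi> h)) = (\<Sum>h\<in>H. if h = 0 then int (card ?P) else 0)"
  proof (rule sum.cong)
    fix h assume h: "h \<in> H"
    show "(\<Sum>\<phi>\<in>?P. sign (p \<phi> h)) = (if h = 0 then int (card ?P) else 0)"
    proof (cases "h = 0")
      case True
      then show ?thesis
        by (simp add: p_def sign_def)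
    next
      case False
      then obtain m where m: "h m \<noteq> 0"
        by (auto simp: fun_eq_iff)
      then have "m \<in> M"
        using h H(1) by (auto simp: supp_in_def)
      let ?d = "\<lambda>x. if x = m then 1 else (0::bit)"
      have d: "?d \<in> ?P"
        using \<open>m \<in> M\<close> by (auto simp: supp_in_def)
      have "p ?d h = (\<Sum>x\<in>M. if x = m then h x else 0)"
        unfolding p_def by (rule sum.cong) auto
      then have "p ?d h = h m"
        using M \<open>m \<in> M\<close> by simp
      then have "sign (p ?d h) = -1"
        using m by (simp add: sign_def)
      then show ?thesis
        using False d
        by (subst sum_sign_eq_0[OF finP, where a = ?d])
          (auto simp: plusP inv p_def sum.distrib distrib_right)
    qed
  qed simp
  also have "\<dots> = int (card ?P)"
    using finH H(2) by simp
  finally have "(\<Sum>h\<in>H. \<Sum>\<phi>\<in>?P. sign (p \<phi> h)) = int (card ?P)" .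
  then have "int (card ?A * card H) = int (card ?P)"
    using 1 sum.swap[of "\<lambda>\<phi> h. sign (p \<phi> h)" H ?P] by linarith
  then have "card ?A * card H = card ?P"
    unfolding of_nat_eq_iff .
  then show ?thesis
    using card_supp_in[OF M] mult.commute[of "card H" "card ?A"] by presburger
qed

section \<open>The dual of the hit problem\<close>

text \<open>The transpose of \<open>Sq k\<close>: the value at \<open>a\<close> is \<phi>(Sq^k x^a),
  with \<open>c\<close> the increment of the exponents.\<close>

definition DSq :: "nat \<Rightarrow> poly \<Rightarrow> poly" where
  "DSq k \<phi> a = (\<Sum>c\<in>mons5 k. of_nat (\<Prod>i<5. a i choose c i) * \<phi> (a + c))"

definition Ker :: "nat \<Rightarrow> poly set" where
  "Ker n = {\<phi> \<in> P5 n. \<forall>k a. 0 < k \<longrightarrow> (\<forall>i\<ge>5. a i = 0) \<longrightarrow> DSq k \<phi> a = 0}"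

lemma P5_eq: "P5 n = supp_in (mons5 n)"
  by (simp add: P5_def supp_in_def)

section \<open>Squares evaluated at arbitrary exponent vectors\<close>

lemma finite_below:
  fixes m :: mon
  assumes "finite {i. m i \<noteq> 0}"
  shows "finite {a. \<forall>i. a i \<le> m i}"
proof -
  let ?I = "{i. m i \<noteq> 0}"
  let ?F = "{a. \<forall>i. (i \<in> ?I \<longrightarrow> a i \<in> {..sum m ?I}) \<and> (i \<notin> ?I \<longrightarrow> a i = 0)}"
  have "{a. \<forall>i. a i \<le> m i} \<subseteq> ?F"
  proof (intro subsetI CollectI allI conjI impI)
    fix a i assume "a \<in> {a. \<forall>i. a i \<le> m i}"
    then have le: "a i \<le> m i"
      by blast
    show "a i \<in> {..sum m ?I}" if "i \<in> ?I"
      using le member_le_sum[OF that, of m] assms by simp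
    show "a i = 0" if "i \<notin> ?I"
      using le that by simp
  qed
  then show ?thesis
    by (rule finite_subset) (rule finite_set_of_finite_funs[OF assms], simp)
qed

lemma mons5_le: "m \<in> mons5 n \<Longrightarrow> m i \<le> n"
  using member_le_sum[of i "{..<5::nat}" m] by (cases "i < 5") (auto simp: mons5_def)

lemma mons5_less: "m \<in> mons5 n \<Longrightarrow> m i \<noteq> 0 \<Longrightarrow> i < 5"
  by (rule ccontr) (simp add: mons5_def)

lemma finite_mons5: "finite (mons5 n)"
proof -
  have "mons5 n \<subseteq> {a. \<forall>i. a i \<le> (if i < 5 then n else 0)}"
    using mons5_le by (auto simp: mons5_def)
  moreover have "finite {i::nat. (if i < 5 then n else 0) \<noteq> (0::nat)}"
    by (rule finite_subset[of _ "{..<5}"]) auto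
  ultimately show ?thesis
    by (rule finite_subset[OF _ finite_below])
qed

text \<open>Finite support of \<open>m\<close> matters here: it makes the defining index set finite,
  so that the sum can be cut down to the exponents in the degree of \<open>g\<close>.\<close>

lemma Sq_eq:
  assumes m: "finite {i. m i \<noteq> 0}" and g: "g \<in> P5 j"
  shows "Sq k g m = (\<Sum>a\<in>{a \<in> mons5 j. (\<forall>i<5. a i \<le> m i) \<and> (\<Sum>i<5. m i - a i) = k}.
    g a * of_nat (\<Prod>i<5. a i choose (m i - a i)))"
  unfolding Sq_def
proof (rule sum.mono_neutral_right)
  show "finite {a. (\<forall>i. a i \<le> m i) \<and> (\<Sum>i<5. m i - a i) = k}"
    using finite_below[OF m] by (rule rev_finite_subset) auto
  show "{a \<in> mons5 j. (\<forall>i<5. a i \<le> m i) \<and> (\<Sum>i<5. m i - a i) = k}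
    \<subseteq> {a. (\<forall>i. a i \<le> m i) \<and> (\<Sum>i<5. m i - a i) = k}"
  proof
    fix a assume a: "a \<in> {a \<in> mons5 j. (\<forall>i<5. a i \<le> m i) \<and> (\<Sum>i<5. m i - a i) = k}"
    then have "a i \<le> m i" for i
      by (cases "i < 5") (auto simp: mons5_def)
    then show "a \<in> {a. (\<forall>i. a i \<le> m i) \<and> (\<Sum>i<5. m i - a i) = k}"
      using a by blast
  qed
  show "\<forall>a\<in>{a. (\<forall>i. a i \<le> m i) \<and> (\<Sum>i<5. m i - a i) = k} -
    {a \<in> mons5 j. (\<forall>i<5. a i \<le> m i) \<and> (\<Sum>i<5. m i - a i) = k}.
    g a * of_nat (\<Prod>i<5. a i choose (m i - a i)) = 0"
    using g by (auto simp: P5_def)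
qed

text \<open>\<^const>\<open>Sq\<close> is also evaluated at exponent vectors that are not supported on the five
  variables. There its value is that at the restricted vector, or \<open>0\<close> if the support is
  infinite, when the defining sum is over an infinite set.\<close>

definition cut :: "mon \<Rightarrow> mon" where
  "cut m = (\<lambda>i. if i < 5 then m i else 0)"

text \<open>Outside the first five places an index vector is constrained only by being below
  \<open>m\<close>. Raising a single such entry from 0 to \<open>m i\<close> gives a different
  admissible vector for each of infinitely many i, so a nonempty index set is infinite.\<close>

lemma Sq_infinite:
  assumes "infinite {i. m i \<noteq> 0}"
  shows "Sq k g m = 0"
proof -
  let ?A = "{a. (\<forall>i. a i \<le> m i) \<and> (\<Sum>i<5. m i - a i) = k}"
  have "infinite ?A" if "a \<in> ?A" for a
  proof -
    let ?I = "{i. m i \<noteq> 0} - {..<5}"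
    have inf: "infinite ?I"
      using assms by simp
    have inj: "inj_on (\<lambda>i. (cut a)(i := m i)) ?I"
    proof (rule inj_onI)
      fix i j assume ij: "i \<in> ?I" "j \<in> ?I" "(cut a)(i := m i) = (cut a)(j := m j)"
      show "i = j"
      proof (rule ccontr)
        assume "i \<noteq> j"
        then have "m i = cut a i"
          using fun_cong[OF ij(3), of i] by simp
        then show False
          using ij(1) by (auto simp: cut_def)
      qed
    qed
    have "(cut a)(i := m i) \<in> ?A" if "i \<in> ?I" for i
    proof -
      have "((cut a)(i := m i)) l \<le> m l" for l
        using \<open>a \<in> ?A\<close> by (simp add: cut_def)
      moreover have "(\<Sum>l<5. m l - ((cut a)(i := m i)) l) = (\<Sum>l<5. m l - a l)"
        using that by (intro sum.cong) (auto simp: cut_def)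
      ultimately show ?thesis
        using \<open>a \<in> ?A\<close> by simp
    qed
    then have img: "(\<lambda>i. (cut a)(i := m i)) ` ?I \<subseteq> ?A"
      by (rule image_subsetI)
    show ?thesis
      using inf finite_imageD[OF finite_subset[OF img] inj] by argo
  qed
  then have "infinite ?A \<or> ?A = {}"
    by blast
  then show ?thesis
    unfolding Sq_def by (elim disjE, intro sum.infinite) (assumption, simp only: sum.empty)
qed

text \<open>A nonzero hit polynomial is not a member of \<open>P5 n\<close>, because it also takes
  nonzero values at vectors with further variables. This property says that its values on
  \<open>mons5 n\<close> determine it, so restriction to \<open>mons5 n\<close> loses
  nothing.\<close>

definition extends :: "nat \<Rightarrow> poly \<Rightarrow> bool" where
  "extends n f \<longleftrightarrow>
    (\<forall>m. f m = (if finite {i. m i \<noteq> 0} \<and> (\<Sum>i<5. m i) = n then f (cut m) else 0))"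

lemma extendsD:
  assumes "extends n f"
  shows "finite {i. m i \<noteq> 0} \<Longrightarrow> (\<Sum>i<5. m i) = n \<Longrightarrow> f m = f (cut m)"
    and "\<not> (finite {i. m i \<noteq> 0} \<and> (\<Sum>i<5. m i) = n) \<Longrightarrow> f m = 0"
  using assms[unfolded extends_def, rule_format, of m] by (auto split: if_splits)

lemma extends_Sq:
  assumes g: "g \<in> P5 j" and n: "j + k = n"
  shows "extends n (Sq k g)"
  unfolding extends_def
proof
  fix m :: mon
  let ?A = "\<lambda>m. {a \<in> mons5 j. (\<forall>i<5. a i \<le> m i) \<and> (\<Sum>i<5. m i - a i) = k}"
  show "Sq k g m = (if finite {i. m i \<noteq> 0} \<and> (\<Sum>i<5. m i) = n then Sq k g (cut m) else 0)"
  proof (cases "finite {i. m i \<noteq> 0}")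
    case True
    have cut: "finite {i. cut m i \<noteq> 0}"
      by (rule finite_subset[OF _ True]) (auto simp: cut_def)
    have "?A m = ?A (cut m)"
      by (auto simp: cut_def)
    then have "Sq k g m = Sq k g (cut m)"
      unfolding Sq_eq[OF True g] Sq_eq[OF cut g] by (auto intro!: sum.cong prod.cong simp: cut_def)
    moreover have "(\<Sum>i<5. m i) = n" if "a \<in> ?A m" for a
    proof -
      have "(\<Sum>i<5. m i) = (\<Sum>i<5. a i + (m i - a i))"
        using that by (intro sum.cong) auto
      also have "\<dots> = j + k"
        using that by (subst sum.distrib) (simp add: mons5_def)
      finally show ?thesis
        using n by simp
    qed
    then have empty: "?A m = {}" if "(\<Sum>i<5. m i) \<noteq> n"
      using that by blast
    have "Sq k g m = 0" if "(\<Sum>i<5. m i) \<noteq> n"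
      unfolding Sq_eq[OF True g] empty[OF that] by (rule sum.empty)
    ultimately show ?thesis
      using True by simp
  next
    case False
    then show ?thesis
      by (simp add: Sq_infinite)
  qed
qed

lemma extends_hit5: "f \<in> hit5 n \<Longrightarrow> extends n f"
  unfolding hit5_def
proof (induction f rule: F2.span_induct)
  case base
  have "extends n (0::poly)"
    by (simp add: extends_def)
  moreover have "extends n (f + g)" if "extends n f" "extends n g" for f g
    unfolding extends_def
  proof
    show "(f + g) m = (if finite {i. m i \<noteq> 0} \<and> (\<Sum>i<5. m i) = n then (f + g) (cut m) else 0)" for m
      using that[unfolded extends_def, rule_format, of m] by (auto split: if_splits)
  qed
  moreover have "extends n (\<lambda>m. c * f m)" if "extends n f" for c f
    unfolding extends_def
  proof
    show "c * f m = (if finite {i. m i \<noteq> 0} \<and> (\<Sum>i<5. m i) = n then c * f (cut m) else 0)" for m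
      using that[unfolded extends_def, rule_format, of m] by (auto split: if_splits)
  qed
  ultimately show ?case
    by (auto simp: F2.subspace_def)
next
  case (step f)
  then obtain k g where "f = Sq k g" "k \<le> n" "g \<in> P5 (n - k)"
    by auto
  then show ?case
    by (simp add: extends_Sq)
qed

text \<open>After exchanging the sums, substitute c = m - a; the binomial coefficients then depend
  on a and c alone.\<close>

lemma pairing_Sq:
  assumes g: "g \<in> P5 j" and n: "j + k = n"
  shows "(\<Sum>m\<in>mons5 n. \<phi> m * Sq k g m) = (\<Sum>a\<in>mons5 j. g a * DSq k \<phi> a)"
proof -
  let ?Q = "\<lambda>m a. (\<forall>i<5. a i \<le> m i) \<and> (\<Sum>i<5. m i - a i) = k"
  let ?b = "\<lambda>m a. of_nat (\<Prod>i<5. a i choose (m i - a i))"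
  have fin: "finite {i. m i \<noteq> 0}" if "m \<in> mons5 n" for m
  proof (rule finite_subset)
    show "{i. m i \<noteq> 0} \<subseteq> {..<5}"
      using that mons5_less by blast
  qed simp
  have "(\<Sum>m\<in>mons5 n. \<phi> m * Sq k g m) =
    (\<Sum>m\<in>mons5 n. \<Sum>a\<in>mons5 j. if ?Q m a then \<phi> m * (g a * ?b m a) else 0)"
    by (rule sum.cong)
      (simp_all add: Sq_eq[OF fin g] sum_distrib_left sum.inter_filter[symmetric] finite_mons5)
  also have "\<dots> = (\<Sum>a\<in>mons5 j. \<Sum>m\<in>mons5 n. if ?Q m a then \<phi> m * (g a * ?b m a) else 0)"
    by (rule sum.swap)
  also have "\<dots> = (\<Sum>a\<in>mons5 j. g a * DSq k \<phi> a)"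
  proof (rule sum.cong)
    fix a assume a: "a \<in> mons5 j"
    have "(\<Sum>m\<in>mons5 n. if ?Q m a then \<phi> m * (g a * ?b m a) else 0) =
      (\<Sum>m\<in>{m\<in>mons5 n. ?Q m a}. \<phi> m * (g a * ?b m a))"
      by (simp only: sum.inter_filter[OF finite_mons5])
    also have "\<dots> = (\<Sum>c\<in>mons5 k. \<phi> (a + c) * (g a * of_nat (\<Prod>i<5. a i choose c i)))"
    proof (rule sum.reindex_bij_witness[where i = "\<lambda>c. a + c" and j = "\<lambda>m i. m i - a i"])
      show "a + (\<lambda>i. m i - a i) = m" if "m \<in> {m\<in>mons5 n. ?Q m a}" for m
      proof
        show "(a + (\<lambda>i. m i - a i)) i = m i" for i
          using that a by (cases "i < 5") (auto simp: mons5_def)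
      qed
      then show "\<phi> (a + (\<lambda>i. m i - a i)) *
          (g a * of_nat (\<Prod>i<5. a i choose (m i - a i))) = \<phi> m * (g a * ?b m a)"
        if "m \<in> {m\<in>mons5 n. ?Q m a}" for m
        using that by simp
      show "(\<lambda>i. m i - a i) \<in> mons5 k" if "m \<in> {m\<in>mons5 n. ?Q m a}" for m
        using that by (auto simp: mons5_def)
      show "(\<lambda>i. (a + c) i - a i) = c" for c
        by auto
      show "a + c \<in> {m\<in>mons5 n. ?Q m a}" if "c \<in> mons5 k" for c
        using that a n by (auto simp: mons5_def sum.distrib)
    qed
    also have "\<dots> = g a * DSq k \<phi> a"
      by (simp add: DSq_def sum_distrib_left mult_ac)
    finally show "(\<Sum>m\<in>mons5 n. if ?Q m a then \<phi> m * (g a * ?b m a) else 0) = g a * DSq k \<phi> a" .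
  qed simp
  finally show ?thesis .
qed

lemma mons5_add: "a \<in> mons5 j \<Longrightarrow> c \<in> mons5 k \<Longrightarrow> a + c \<in> mons5 (j + k)"
  by (auto simp: mons5_def sum.distrib)

lemma DSq_outside:
  assumes "\<phi> \<in> P5 n" "(\<Sum>i<5. a i) + k \<noteq> n"
  shows "DSq k \<phi> a = 0"
proof -
  have "a + c \<notin> mons5 n" if "c \<in> mons5 k" for c
    using that assms(2) by (auto simp: mons5_def sum.distrib)
  then have "\<phi> (a + c) = 0" if "c \<in> mons5 k" for c
    using that assms(1) by (auto simp: P5_def)
  then show ?thesis
    by (simp add: DSq_def)
qed

definition restr :: "nat \<Rightarrow> poly \<Rightarrow> poly" where
  "restr n f = (\<lambda>m. if m \<in> mons5 n then f m else 0)"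

lemma sum_restr: "(\<Sum>m\<in>mons5 n. \<phi> m * restr n h m) = (\<Sum>m\<in>mons5 n. \<phi> m * h m)"
  by (rule sum.cong) (auto simp: restr_def)

text \<open>Hit polynomials are spanned by squares of homogeneous polynomials, so by adjointness
  vanishing on them makes \<open>DSq k \<phi>\<close> orthogonal to every \<open>g\<close>. Taking a
  single monomial for \<open>g\<close> isolates one value of \<open>DSq k \<phi>\<close>.\<close>

lemma Ker_eq_annihilator:
  "Ker n = {\<phi> \<in> supp_in (mons5 n).
    \<forall>h\<in>restr n ` hit5 n. (\<Sum>m\<in>mons5 n. \<phi> m * h m) = 0}" (is "_ = ?R")
proof (intro set_eqI iffI)
  fix \<phi> assume \<phi>: "\<phi> \<in> Ker n"
  have "(\<Sum>m\<in>mons5 n. \<phi> m * h m) = 0" if "h \<in> hit5 n" for h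
    using that unfolding hit5_def
  proof (induction h rule: F2.span_induct)
    case base
    have "(\<Sum>m\<in>mons5 n. \<phi> m * (c * f m)) = c * (\<Sum>m\<in>mons5 n. \<phi> m * f m)" for c f
      unfolding sum_distrib_left by (rule sum.cong) (simp_all add: mult.left_commute)
    then show ?case
      by (auto simp: F2.subspace_def distrib_left sum.distrib)
  next
    case (step h)
    then obtain k g where h: "h = Sq k g" "0 < k" "k \<le> n" "g \<in> P5 (n - k)"
      by auto
    have "DSq k \<phi> a = 0" if "a \<in> mons5 (n - k)" for a
      using that \<phi> h(2) by (auto simp: Ker_def mons5_def)
    then show ?case
      using h by (simp add: pairing_Sq)
  qed
  then show "\<phi> \<in> ?R"
    using \<phi> by (auto simp: Ker_def P5_eq sum_restr)
next
  fix \<phi> assume \<phi>: "\<phi> \<in> ?R"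
  have "DSq k \<phi> a = 0" if k: "0 < k" and a: "\<forall>i\<ge>5. a i = 0" for k a
  proof (cases "(\<Sum>i<5. a i) + k = n")
    case True
    let ?g = "\<lambda>x. if x = a then 1 else (0::bit)"
    have am: "a \<in> mons5 (n - k)"
      using True a by (auto simp: mons5_def)
    then have g: "?g \<in> P5 (n - k)"
      by (auto simp: P5_def)
    then have "Sq k ?g \<in> hit5 n"
      unfolding hit5_def using k True
      by (intro F2.span_base CollectI exI[of _ k] exI[of _ ?g]) simp_all
    then have "0 = (\<Sum>m\<in>mons5 n. \<phi> m * Sq k ?g m)"
      using \<phi> by (simp add: sum_restr)
    also have "\<dots> = (\<Sum>x\<in>mons5 (n - k). ?g x * DSq k \<phi> x)"
      using True by (intro pairing_Sq[OF g]) auto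
    also have "\<dots> = (\<Sum>x\<in>mons5 (n - k). if x = a then DSq k \<phi> x else 0)"
      by (rule sum.cong) auto
    also have "\<dots> = DSq k \<phi> a"
      using am by (simp add: finite_mons5)
    finally show ?thesis by simp
  next
    case False
    then show ?thesis
      using \<phi> by (intro DSq_outside) (auto simp: P5_eq)
  qed
  then show "\<phi> \<in> Ker n"
    using \<phi> by (auto simp: Ker_def P5_eq)
qed

text \<open>Restriction is injective on \<open>hit5 n\<close>, and \<open>Ker n\<close> is the
  annihilator of the image. Hence card (hit5 n) * card (Ker n) = card (P5 n), and comparing
  exponents of 2 gives the difference of dimensions.\<close>

lemma dimQP5_eq:
  assumes "card (Ker n) = 2 ^ e"
  shows "dimQP5 n = e"
proof -
  let ?M = "mons5 n" and ?H = "restr n ` hit5 n"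
  have sub: "F2.subspace (hit5 n)"
    unfolding hit5_def by (rule F2.subspace_span)
  have inj: "inj_on (restr n) (hit5 n)"
  proof (rule inj_onI)
    fix f g assume "f \<in> hit5 n" "g \<in> hit5 n" and eq: "restr n f = restr n g"
    then have fg: "extends n f" "extends n g"
      by (auto intro: extends_hit5)
    show "f = g"
    proof
      fix m
      show "f m = g m"
      proof (cases "finite {i. m i \<noteq> 0} \<and> (\<Sum>i<5. m i) = n")
        case True
        then have "cut m \<in> ?M"
          by (simp add: cut_def mons5_def)
        then have "f (cut m) = g (cut m)"
          using fun_cong[OF eq, of "cut m"] by (simp only: restr_def if_True)
        then show ?thesis
          using True by (simp add: extendsD[OF fg(1)] extendsD[OF fg(2)])
      next
        case False
        then show ?thesis
          by (simp add: extendsD(2)[OF fg(1)] extendsD(2)[OF fg(2)])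
      qed
    qed
  qed
  have H: "?H \<subseteq> supp_in ?M"
    by (auto simp: restr_def supp_in_def split: if_splits)
  have finP: "finite (supp_in ?M)"
    by (rule finite_supp_in[OF finite_mons5])
  have fin: "finite (hit5 n)"
    using finite_subset[OF H finP] inj by (rule finite_imageD)
  have "restr n f + restr n g \<in> ?H" if "f \<in> hit5 n" "g \<in> hit5 n" for f g
  proof -
    have "restr n (f + g) = restr n f + restr n g"
      by (auto simp: restr_def fun_eq_iff)
    then show ?thesis
      using imageI[OF F2.subspace_add[OF sub that], of "restr n"] by (simp only:)
  qed
  moreover have "0 \<in> ?H"
    by (rule rev_image_eqI[OF F2.subspace_0[OF sub]]) (simp add: restr_def fun_eq_iff)
  ultimately have "card ?H * card (Ker n) = 2 ^ card ?M"
    unfolding Ker_eq_annihilator by (intro card_annihilator[OF finite_mons5 H]) auto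
  moreover have "card ?H = 2 ^ F2.dim (hit5 n)"
    using card_image[OF inj] card_F2_subspace[OF sub fin] by simp
  moreover have "F2.subspace (P5 n)"
    unfolding F2.subspace_def P5_def
  proof (intro conjI allI impI ballI CollectI)
    fix f g :: poly and m
    assume f: "f \<in> {f. \<forall>m. f m \<noteq> 0 \<longrightarrow> m \<in> ?M}" and g: "g \<in> {f. \<forall>m. f m \<noteq> 0 \<longrightarrow> m \<in> ?M}"
      and "(f + g) m \<noteq> 0"
    then show "m \<in> ?M"
      by (cases "f m = 0") auto
  qed auto
  then have "2 ^ F2.dim (P5 n) = (2::nat) ^ card ?M"
    using card_F2_subspace[of "P5 n"] finP card_supp_in[OF finite_mons5] by (simp add: P5_eq)
  ultimately have "(2::nat) ^ (F2.dim (hit5 n) + e) = 2 ^ F2.dim (P5 n)"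
    using assms by (simp add: power_add)
  then show ?thesis
    unfolding dimQP5_def by simp
qed

section \<open>Separating even and odd exponents\<close>

text \<open>Pascal's rule applied twice; the middle term occurs twice and vanishes mod 2.\<close>

lemma choose_Suc_Suc_bit:
  "of_nat (Suc (Suc k) choose Suc (Suc l)) =
    (of_nat (k choose Suc (Suc l)) + of_nat (k choose l) :: bit)"
proof -
  have "Suc (Suc k) choose Suc (Suc l) =
    2 * (k choose Suc l) + ((k choose Suc (Suc l)) + (k choose l))"
    by simp
  then have "of_nat (Suc (Suc k) choose Suc (Suc l)) =
    (of_nat (2 * (k choose Suc l) + ((k choose Suc (Suc l)) + (k choose l))) :: bit)"
    by (simp only:)
  then show ?thesis
    by (simp only: of_nat_add of_nat_mult of_nat_numeral bit_2_eq_0 mult_zero_left add_0)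
qed

text \<open>Lucas' theorem mod 2 at the lowest binary digit, for an even upper entry.\<close>

lemma choose_double:
  "of_nat (2 * b choose (2 * c)) = (of_nat (b choose c) :: bit) \<and>
   of_nat (2 * b choose Suc (2 * c)) = (0 :: bit)"
proof (induction b arbitrary: c)
  case 0
  show ?case
    by (cases c) auto
next
  case (Suc b)
  show ?case
  proof (cases c)
    case 0
    then show ?thesis
      using Suc.IH[of 0] by simp
  next
    case (Suc c')
    then show ?thesis
      using Suc.IH[of c'] Suc.IH[of c] choose_Suc_Suc_bit[of "2 * b" "2 * c'"]
        choose_Suc_Suc_bit[of "2 * b" "Suc (2 * c')"]
      by (simp only: mult_Suc_right add_2_eq_Suc binomial_Suc_Suc[of b] of_nat_add add_0 add.commute
          simp_thms)
  qed
qed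

lemmas choose_even_even = choose_double[THEN conjunct1]
  and choose_even_odd = choose_double[THEN conjunct2]

text \<open>Coefficientwise form of (1 + t)^(v + 2^p) = (1 + t)^v (1 + t^(2^p)) mod 2. In the
  induction two shifts by 2^p are composed and the mixed terms cancel.\<close>

lemma choose_add_power_2:
  "of_nat (v + 2 ^ p choose c) =
    (of_nat (v choose c) + (if 2 ^ p \<le> c then of_nat (v choose (c - 2 ^ p)) else 0) :: bit)"
proof (induction p arbitrary: v c)
  case 0
  then show ?case
    by (cases c) (auto simp: add.commute)
next
  case (Suc p)
  define t :: nat where "t = 2 ^ p"
  have c: "c - t - t = c - (t + t)" "t \<le> c - t \<longleftrightarrow> t + t \<le> c \<or> t = 0"
    by auto
  have "of_nat (v + t + t choose c) =
    (of_nat (v choose c) + (if t \<le> c then of_nat (v choose (c - t)) else 0) +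
     (if t \<le> c then of_nat (v choose (c - t)) +
       (if t \<le> c - t then of_nat (v choose (c - t - t)) else 0) else 0) :: bit)"
    using Suc.IH[of "v + t" c] Suc.IH[of v c] Suc.IH[of v "c - t"] unfolding t_def[symmetric]
    by simp
  also have "\<dots> = of_nat (v choose c) + (if t + t \<le> c then of_nat (v choose (c - (t + t))) else 0)"
    unfolding c by (auto simp: add.assoc t_def)
  finally show ?case
    by (simp add: t_def mult_2 add.assoc)
qed

definition ind :: "nat set \<Rightarrow> mon" where
  "ind E = (\<lambda>i. if i \<in> E then 1 else 0)"

text \<open>\<open>en E b\<close> is the exponent vector of \<open>x\<^sub>E (x\<^sup>b)\<^sup>2\<close>, where \<open>x\<^sub>E\<close> is the product of the \<open>x\<^sub>i\<close> with
  \<open>i \<in> E\<close>.\<close>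

definition en :: "nat set \<Rightarrow> mon \<Rightarrow> mon" where
  "en E b = (\<lambda>i. (if i \<in> E then 1 else 0) + 2 * b i)"

lemma en_decomp: "a = en {i. odd (a i)} (\<lambda>i. a i div 2)"
  by (auto simp: fun_eq_iff en_def)

lemma sum_en: "E \<subseteq> {..<5} \<Longrightarrow> (\<Sum>i<5. en E b i) = card E + 2 * (\<Sum>i<5. b i)"
  by (simp add: en_def sum.distrib sum_distrib_left sum.If_cases Int_absorb1)

lemma en_mons5: "E \<subseteq> {..<5} \<Longrightarrow>
  en E b \<in> mons5 n \<longleftrightarrow> (\<forall>i\<ge>5. b i = 0) \<and> card E + 2 * (\<Sum>i<5. b i) = n"
  unfolding mons5_def using sum_en[of E b] by (auto simp: en_def)

lemma en_add: "F \<subseteq> E \<Longrightarrow> en E b + en F c = en (E - F) (b + ind F + c)"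
  by (auto simp: fun_eq_iff en_def ind_def)

lemma en_add_ind:
  "en E b + ind {j} = (if j \<in> E then en (E - {j}) (b + ind {j}) else en (insert j E) b)"
  by (auto simp: fun_eq_iff en_def ind_def)

lemma card_subset5: "E \<subseteq> {..<5::nat} \<Longrightarrow> card E \<le> 5"
  using card_mono[of "{..<5::nat}" E] by simp

lemma finite_subset5: "E \<subseteq> {..<5::nat} \<Longrightarrow> finite E"
  by (erule finite_subset) simp

lemma sum_mons5_en:
  "(\<Sum>c\<in>mons5 k. h c) =
    (\<Sum>F\<in>{F \<in> Pow {..<5}. card F \<le> k \<and> even (k - card F)}.
      \<Sum>c\<in>mons5 ((k - card F) div 2). h (en F c))"
proof -
  let ?S = "{F \<in> Pow {..<5::nat}. card F \<le> k \<and> even (k - card F)}"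
  have "(\<Sum>c\<in>mons5 k. h c) = (\<Sum>(F, c)\<in>Sigma ?S (\<lambda>F. mons5 ((k - card F) div 2)). h (en F c))"
  proof (rule sum.reindex_bij_witness[where i = "\<lambda>(F, c). en F c"
        and j = "\<lambda>a. ({i. odd (a i)}, \<lambda>i. a i div 2)"])
    fix a assume a: "a \<in> mons5 k"
    show "(case ({i. odd (a i)}, \<lambda>i. a i div 2) of (F, c) \<Rightarrow> en F c) = a"
      using en_decomp[of a] by simp
    then show "(case ({i. odd (a i)}, \<lambda>i. a i div 2) of (F, c) \<Rightarrow> h (en F c)) = h a"
      by simp
    have F: "{i. odd (a i)} \<subseteq> {..<5}"
    proof
      fix i assume "i \<in> {i. odd (a i)}"
      then have "a i \<noteq> 0"
        by (auto intro: odd_pos)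
      then show "i \<in> {..<5}"
        using mons5_less[OF a] by blast
    qed
    have "en {i. odd (a i)} (\<lambda>i. a i div 2) \<in> mons5 k"
      using a by (subst (asm) en_decomp)
    then show "({i. odd (a i)}, \<lambda>i. a i div 2) \<in> Sigma ?S (\<lambda>F. mons5 ((k - card F) div 2))"
      unfolding en_mons5[OF F] using F by (auto simp: mons5_def)
  next
    fix x assume "x \<in> Sigma ?S (\<lambda>F. mons5 ((k - card F) div 2))"
    then obtain F c where x: "x = (F, c)" "F \<subseteq> {..<5}" "card F \<le> k" "even (k - card F)"
      "c \<in> mons5 ((k - card F) div 2)"
      by auto
    then show "(case x of (F, c) \<Rightarrow> en F c) \<in> mons5 k"
      by (auto simp: en_mons5) (auto simp: mons5_def)
    have "{i. odd (en F c i)} = F" "(\<lambda>i. en F c i div 2) = c"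
      by (auto simp: en_def)
    then show "({i. odd ((case x of (F, c) \<Rightarrow> en F c) i)},
      \<lambda>i. (case x of (F, c) \<Rightarrow> en F c) i div 2) = x"
      using x(1) by simp
  qed
  also have "\<dots> = (\<Sum>F\<in>?S. \<Sum>c\<in>mons5 ((k - card F) div 2). h (en F c))"
    by (rule sum.Sigma[symmetric]) (auto simp: finite_mons5)
  finally show ?thesis .
qed

lemma choose_en:
  "of_nat (\<Prod>i<5. en E b i choose en F c i) =
    (if F \<inter> {..<5} \<subseteq> E then of_nat (\<Prod>i<5. b i choose c i) else 0 :: bit)"
proof -
  have *: "of_nat (en E b i choose en F c i) =
    (if i \<in> F \<and> i \<notin> E then 0 else of_nat (b i choose c i) :: bit)" for i
  proof (cases "i \<in> E"; cases "i \<in> F")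
    assume "i \<in> E" "i \<notin> F"
    then show ?thesis
      using choose_even_even[of "b i" "c i"] choose_even_odd[of "b i" "c i - 1"]
      by (cases "c i") (auto simp: en_def)
  qed (auto simp: en_def choose_even_even choose_even_odd)
  show ?thesis
    unfolding of_nat_prod *
    by (auto intro!: prod.cong)
qed

text \<open>Cartan formula for x_E y^2 with y = x^b. Each variable of \<open>E\<close> is either
  kept or squared, \<open>F\<close> being the set of squared ones, which move into the even part as
  \<open>b + ind F\<close>. On y^2 only even squares act, by Sq^(2l) (y^2) = (Sq^l y)^2.\<close>

lemma DSq_en:
  assumes E: "E \<subseteq> {..<5}"
  shows "DSq k \<phi> (en E b) = (\<Sum>F\<in>{F. F \<subseteq> E \<and> card F \<le> k \<and> even (k - card F)}.
    \<Sum>c\<in>mons5 ((k - card F) div 2).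
      of_nat (\<Prod>i<5. b i choose c i) * \<phi> (en (E - F) (b + ind F + c)))"
proof -
  let ?S = "{F \<in> Pow {..<5::nat}. card F \<le> k \<and> even (k - card F)}"
  have "DSq k \<phi> (en E b) = (\<Sum>F\<in>?S. \<Sum>c\<in>mons5 ((k - card F) div 2).
    of_nat (\<Prod>i<5. en E b i choose en F c i) * \<phi> (en E b + en F c))"
    unfolding DSq_def by (rule sum_mons5_en)
  also have "\<dots> = (\<Sum>F\<in>{F. F \<subseteq> E \<and> card F \<le> k \<and> even (k - card F)}.
    \<Sum>c\<in>mons5 ((k - card F) div 2).
    of_nat (\<Prod>i<5. en E b i choose en F c i) * \<phi> (en E b + en F c))"
  proof (rule sum.mono_neutral_right)
    show "{F. F \<subseteq> E \<and> card F \<le> k \<and> even (k - card F)} \<subseteq> ?S"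
      using E by auto
    show "\<forall>F\<in>?S - {F. F \<subseteq> E \<and> card F \<le> k \<and> even (k - card F)}.
      (\<Sum>c\<in>mons5 ((k - card F) div 2).
      of_nat (\<Prod>i<5. en E b i choose en F c i) * \<phi> (en E b + en F c)) = 0"
    proof
      fix F assume "F \<in> ?S - {F. F \<subseteq> E \<and> card F \<le> k \<and> even (k - card F)}"
      then have "\<not> F \<inter> {..<5} \<subseteq> E"
        by auto
      then show "(\<Sum>c\<in>mons5 ((k - card F) div 2).
        of_nat (\<Prod>i<5. en E b i choose en F c i) * \<phi> (en E b + en F c)) = 0"
        unfolding choose_en by simp
    qed
  qed simp
  also have "\<dots> = (\<Sum>F\<in>{F. F \<subseteq> E \<and> card F \<le> k \<and> even (k - card F)}.
    \<Sum>c\<in>mons5 ((k - card F) div 2).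
      of_nat (\<Prod>i<5. b i choose c i) * \<phi> (en (E - F) (b + ind F + c)))"
  proof (intro sum.cong refl)
    fix F c assume "F \<in> {F. F \<subseteq> E \<and> card F \<le> k \<and> even (k - card F)}"
    then have "F \<subseteq> E"
      by simp
    then show "of_nat (\<Prod>i<5. en E b i choose en F c i) * \<phi> (en E b + en F c) =
      of_nat (\<Prod>i<5. b i choose c i) * \<phi> (en (E - F) (b + ind F + c))"
      unfolding choose_en using en_add[of F E b c] by auto
  qed
  finally show ?thesis .
qed

section \<open>Reduction to functionals on the squared part\<close>

definition odd4 :: "poly \<Rightarrow> bool" where
  "odd4 \<phi> \<longleftrightarrow> (\<forall>E b. E \<subseteq> {..<5} \<longrightarrow> card E \<noteq> 4 \<longrightarrow> \<phi> (en E b) = 0)"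

definition part :: "poly \<Rightarrow> nat \<Rightarrow> poly" where
  "part \<phi> j = (\<lambda>b. \<phi> (en ({..<5} - {j}) b))"

definition contract :: "(nat \<Rightarrow> poly) \<Rightarrow> bool" where
  "contract \<psi> \<longleftrightarrow> (\<forall>v. (\<forall>i\<ge>5. v i = 0) \<longrightarrow> (\<Sum>j<5. \<psi> j (v + ind {j})) = 0)"

lemma ind_empty: "ind {} = 0"
  by (simp add: ind_def fun_eq_iff)

lemma mons5_0: "mons5 0 = {0}"
proof (intro set_eqI iffI)
  fix a assume "a \<in> mons5 0"
  then show "a \<in> {0}"
    using mons5_le[of a 0] by (simp add: fun_eq_iff)
qed (simp add: mons5_def)

lemma DSq_0: "DSq 0 \<phi> a = \<phi> a"
  by (simp add: DSq_def mons5_0)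

lemma odd4D: "odd4 \<phi> \<Longrightarrow> E \<subseteq> {..<5} \<Longrightarrow> card E \<noteq> 4 \<Longrightarrow> \<phi> (en E b) = 0"
  by (simp add: odd4_def)

text \<open>On x_E y^2 squares never increase the number of odd exponents, so no term has four of
  them.\<close>

lemma DSq_card_less_4:
  assumes "odd4 \<phi>" "E \<subseteq> {..<5}" "card E < 4"
  shows "DSq k \<phi> (en E b) = 0"
proof -
  have "\<phi> (en (E - F) c) = 0" if "F \<subseteq> E" for F c
  proof (rule odd4D[OF assms(1)])
    have "card (E - F) \<le> card E"
      by (intro card_mono finite_subset5 assms) auto
    then show "card (E - F) \<noteq> 4"
      using assms(3) by linarith
  qed (use assms in auto)
  then show ?thesis
    unfolding DSq_en[OF assms(2)] by simp
qed

text \<open>Only \<open>F = {}\<close> keeps four odd exponents, so the square acts on the squared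
  part alone.\<close>

lemma DSq_card_4:
  assumes "odd4 \<phi>" "E \<subseteq> {..<5}" "card E = 4"
  shows "DSq k \<phi> (en E b) = (if even k then DSq (k div 2) (\<lambda>c. \<phi> (en E c)) b else 0)"
proof -
  let ?S = "{F. F \<subseteq> E \<and> card F \<le> k \<and> even (k - card F)}"
  let ?T = "\<lambda>F. \<Sum>c\<in>mons5 ((k - card F) div 2).
      of_nat (\<Prod>i<5. b i choose c i) * \<phi> (en (E - F) (b + ind F + c))"
  have fin: "finite E"
    using assms(2) by (rule finite_subset5)
  have "\<phi> (en (E - F) c) = 0" if "F \<subseteq> E" "F \<noteq> {}" for F c
  proof (rule odd4D[OF assms(1)])
    have "card (E - F) < card E"
      using that fin by (intro psubset_card_mono) auto
    then show "card (E - F) \<noteq> 4"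
      using assms(3) by linarith
  qed (use assms in auto)
  then have "(\<Sum>F\<in>?S. ?T F) = (\<Sum>F\<in>?S. if F = {} then ?T F else 0)"
    by (intro sum.cong) auto
  also have "\<dots> = (if {} \<in> ?S then ?T {} else 0)"
    using fin by (simp add: sum.delta)
  finally show ?thesis
    unfolding DSq_en[OF assms(2)] by (simp add: DSq_def ind_empty)
qed

text \<open>Exactly one of the five odd variables has to be squared to leave four odd exponents; the
  sum over it is the contraction.\<close>

lemma DSq_card_5:
  assumes "odd4 \<phi>"
  shows "DSq k \<phi> (en {..<5} b) =
    (if odd k then DSq (k div 2) (\<lambda>c. \<Sum>j<5. part \<phi> j (c + ind {j})) b else 0)"
proof -
  let ?S = "{F. F \<subseteq> {..<5::nat} \<and> card F \<le> k \<and> even (k - card F)}"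
  let ?T = "\<lambda>F. \<Sum>c\<in>mons5 ((k - card F) div 2).
      of_nat (\<Prod>i<5. b i choose c i) * \<phi> (en ({..<5} - F) (b + ind F + c))"
  have S: "?S \<inter> {F. card F = 1} = (if odd k then (\<lambda>j. {j}) ` {..<5} else {})"
    by (auto simp: card_1_singleton_iff elim: oddE)
  have "\<phi> (en ({..<5} - F) c) = 0" if "F \<subseteq> {..<5}" "card F \<noteq> 1" for F c
  proof (rule odd4D[OF assms(1)])
    show "card ({..<5} - F) \<noteq> 4"
      using that card_Diff_subset[of F "{..<5}"] finite_subset5[of F] card_subset5[of F] by auto
  qed auto
  then have "(\<Sum>F\<in>?S. ?T F) = (\<Sum>F\<in>?S. if card F = 1 then ?T F else 0)"
    by (intro sum.cong) auto
  also have "\<dots> = (\<Sum>F\<in>?S \<inter> {F. card F = 1}. ?T F)"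
    by (simp add: sum.If_cases)
  also have "\<dots> = (if odd k then \<Sum>j<5. ?T {j} else 0)"
    unfolding S by (simp add: sum.reindex)
  also have "\<dots> = (if odd k then DSq (k div 2) (\<lambda>c. \<Sum>j<5. part \<phi> j (c + ind {j})) b else 0)"
  proof -
    have "(\<Sum>j<5. ?T {j}) = DSq ((k - 1) div 2) (\<lambda>c. \<Sum>j<5. part \<phi> j (c + ind {j})) b"
      unfolding DSq_def part_def sum_distrib_left
      by (subst sum.swap) (simp add: ac_simps)
    moreover have "odd k \<Longrightarrow> (k - 1) div 2 = k div 2"
      by (elim oddE) simp
    ultimately show ?thesis
      by (cases "odd k") simp_all
  qed
  finally show ?thesis
    unfolding DSq_en[OF order_refl] .
qed

lemma DSq_cong: "(\<And>c. (\<forall>i\<ge>5. c i = 0) \<Longrightarrow> \<phi> c = \<psi> c) \<Longrightarrow> (\<forall>i\<ge>5. a i = 0) \<Longrightarrow>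
  DSq k \<phi> a = DSq k \<psi> a"
  unfolding DSq_def by (intro sum.cong) (auto simp: mons5_def)

lemma part_P5: "\<phi> \<in> P5 (4 + 2 * m) \<Longrightarrow> j < 5 \<Longrightarrow> part \<phi> j \<in> P5 m"
proof -
  assume \<phi>: "\<phi> \<in> P5 (4 + 2 * m)" and j: "j < 5"
  have "b \<in> mons5 m" if "en ({..<5} - {j}) b \<in> mons5 (4 + 2 * m)" for b
    using that j by (simp add: en_mons5) (simp add: mons5_def)
  then show ?thesis
    using \<phi> by (auto simp: P5_def part_def)
qed

lemma Ker_P5: "\<phi> \<in> Ker n \<Longrightarrow> \<phi> \<in> P5 n"
  by (simp add: Ker_def)

lemma subset5_cases:
  fixes E :: "nat set"
  assumes "E \<subseteq> {..<5}"
  obtains "card E < 4" | j where "j < 5" "E = {..<5} - {j}" | "E = {..<5}"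
proof -
  consider "card E < 4" | "card E = 4" | "card E = 5"
    using card_subset5[OF assms] by linarith
  then show ?thesis
  proof cases
    case 2
    then have "card ({..<5} - E) = 1"
      using assms card_Diff_subset[OF finite_subset5[OF assms] assms] by simp
    then obtain j where "{..<5} - E = {j}"
      by (auto simp: card_1_singleton_iff)
    then have "j < 5" "E = {..<5} - {j}"
      using assms by auto
    then show ?thesis
      using that by blast
  next
    case 3
    then show ?thesis
      using card_subset_eq[OF _ assms] that by simp
  qed (use that in blast)
qed

text \<open>The conditions at x_E y^2 are sorted by the size of \<open>E\<close>. Fewer than four
  elements give nothing, four give the kernel conditions for the parts, and five give the dual
  squares of the contraction, all of which follow from \<open>k = 1\<close>, the vanishing of the
  contraction itself.\<close>

lemma Ker_rec:
  assumes P: "\<phi> \<in> P5 (4 + 2 * m)" and o: "odd4 \<phi>"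
  shows "\<phi> \<in> Ker (4 + 2 * m) \<longleftrightarrow> (\<forall>j<5. part \<phi> j \<in> Ker m) \<and> contract (part \<phi>)"
proof (intro iffI conjI allI impI)
  assume \<phi>: "\<phi> \<in> Ker (4 + 2 * m)"
  show "part \<phi> j \<in> Ker m" if j: "j < 5" for j
  proof -
    have "DSq k (part \<phi> j) b = 0" if "0 < k" "\<forall>i\<ge>5. b i = 0" for k b
    proof -
      have "0 = DSq (2 * k) \<phi> (en ({..<5} - {j}) b)"
        using \<phi> that by (auto simp: Ker_def en_def)
      also have "\<dots> = DSq k (part \<phi> j) b"
        using j by (subst DSq_card_4[OF o]) (auto simp: part_def)
      finally show ?thesis by simp
    qed
    then show ?thesis
      using part_P5[OF P j] by (simp add: Ker_def)
  qed
  show "contract (part \<phi>)"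
    unfolding contract_def
  proof (intro allI impI)
    fix v :: mon assume "\<forall>i\<ge>5. v i = 0"
    then have "0 = DSq 1 \<phi> (en {..<5} v)"
      using \<phi> by (auto simp: Ker_def en_def)
    then show "(\<Sum>j<5. part \<phi> j (v + ind {j})) = 0"
      by (simp add: DSq_card_5[OF o] DSq_0)
  qed
next
  assume r: "(\<forall>j<5. part \<phi> j \<in> Ker m) \<and> contract (part \<phi>)"
  have "DSq k \<phi> a = 0" if k: "0 < k" and a: "\<forall>i\<ge>5. a i = 0" for k a
  proof -
    define E b where "E = {i. odd (a i)}" and "b = (\<lambda>i. a i div 2)"
    have ab: "a = en E b"
      unfolding E_def b_def by (rule en_decomp)
    have E: "E \<subseteq> {..<5}"
    proof
      fix i assume "i \<in> E"
      then show "i \<in> {..<5}"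
        using a by (cases "i < 5") (auto simp: E_def)
    qed
    have b: "\<forall>i\<ge>5. b i = 0"
      using a by (simp add: b_def)
    show ?thesis
      using E
    proof (cases rule: subset5_cases)
      case 1
      then show ?thesis
        unfolding ab by (rule DSq_card_less_4[OF o E])
    next
      case (2 j)
      then show ?thesis
        using r k b unfolding ab
        by (subst DSq_card_4[OF o E]) (auto simp: Ker_def part_def elim: evenE)
    next
      case 3
      have "DSq l (\<lambda>c. \<Sum>j<5. part \<phi> j (c + ind {j})) b = DSq l (\<lambda>c. 0) b" for l
        using r b by (intro DSq_cong) (auto simp: contract_def)
      then show ?thesis
        unfolding ab 3 DSq_card_5[OF o] by (simp add: DSq_def)
    qed
  qed
  then show "\<phi> \<in> Ker (4 + 2 * m)"
    using P by (simp add: Ker_def)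
qed

text \<open>Inverse of the passage to parts: the set of odd exponents of \<open>a\<close> selects
  the functional to be used.\<close>

definition glue :: "(nat \<Rightarrow> poly) \<Rightarrow> poly" where
  "glue \<psi> a = (\<Sum>j<5. if {i. odd (a i)} = {..<5} - {j} then \<psi> j (\<lambda>i. a i div 2) else 0)"

lemma glue_en: "glue \<psi> (en E b) = (\<Sum>j<5. if E = {..<5} - {j} then \<psi> j b else 0)"
proof -
  have "{i. odd (en E b i)} = E" "(\<lambda>i. en E b i div 2) = b"
    by (auto simp: en_def)
  then show ?thesis
    by (simp only: glue_def)
qed

lemma part_glue:
  assumes "j < 5"
  shows "part (glue \<psi>) j = \<psi> j"
proof
  fix b
  have "{..<5} - {j} = {..<5} - {i} \<longleftrightarrow> i = j" if "i < 5" for i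
    using that assms by auto
  then have "part (glue \<psi>) j b = (\<Sum>i<5. if i = j then \<psi> i b else 0)"
    unfolding part_def glue_en by (intro sum.cong) auto
  then show "part (glue \<psi>) j b = \<psi> j b"
    using assms by simp
qed

lemma odd4_glue: "odd4 (glue \<psi>)"
  unfolding odd4_def
proof (intro allI impI)
  fix E :: "nat set" and b assume "card E \<noteq> 4"
  then have "E \<noteq> {..<5} - {j}" if "j < 5" for j
    using that by auto
  then show "glue \<psi> (en E b) = 0"
    unfolding glue_en by (intro sum.neutral) auto
qed

lemma glue_P5:
  assumes "\<forall>j<5. \<psi> j \<in> P5 m"
  shows "glue \<psi> \<in> P5 (4 + 2 * m)"
proof -
  have "a \<in> mons5 (4 + 2 * m)" if nz: "glue \<psi> a \<noteq> 0" for a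
  proof -
    obtain E b where a: "a = en E b"
      using en_decomp by blast
    obtain j where "j \<in> {..<5}" "(if E = {..<5} - {j} then \<psi> j b else 0) \<noteq> 0"
      using nz unfolding a glue_en by (rule sum.not_neutral_contains_not_neutral)
    then have j: "j < 5" "E = {..<5} - {j}" "\<psi> j b \<noteq> 0"
      by (auto split: if_splits)
    then have "b \<in> mons5 m"
      using assms by (auto simp: P5_def)
    then show ?thesis
      unfolding a j(2) using j(1) by (simp add: en_mons5) (simp add: mons5_def)
  qed
  then show ?thesis
    by (auto simp: P5_def)
qed

lemma odd4_eqI:
  assumes "odd4 \<phi>" "odd4 \<psi>" "\<phi> \<in> P5 n" "\<psi> \<in> P5 n" "\<And>j. j < 5 \<Longrightarrow> part \<phi> j = part \<psi> j"
  shows "\<phi> = \<psi>"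
proof
  fix a
  obtain E b where a: "a = en E b"
    using en_decomp by blast
  show "\<phi> a = \<psi> a"
  proof (cases "E \<subseteq> {..<5} \<and> card E = 4")
    case True
    obtain j where "j < 5" "E = {..<5} - {j}"
      using True by (cases rule: subset5_cases[OF conjunct1[OF True]]) auto
    then show ?thesis
      using fun_cong[OF assms(5)[of j], of b] by (simp add: a part_def)
  next
    case False
    then consider "E \<subseteq> {..<5}" "card E \<noteq> 4" | i where "i \<in> E" "5 \<le> i"
      by (meson lessThan_iff not_less subsetI)
    then show ?thesis
    proof cases
      case 1
      then show ?thesis
        unfolding a by (simp add: odd4D[OF assms(1)] odd4D[OF assms(2)])
    next
      case 2
      then have "a \<notin> mons5 n"
        by (auto simp: a mons5_def en_def intro!: exI[of _ i])
      then have "\<phi> a = 0" "\<psi> a = 0"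
        using assms(3,4) unfolding P5_def by blast+
      then show ?thesis
        by simp
    qed
  qed
qed

section \<open>Vanishing on monomials with two odd exponents\<close>

definition sgl :: "nat \<Rightarrow> nat \<Rightarrow> mon" where
  "sgl a t = (\<lambda>k. if k = a then t else 0)"

text \<open>The value \<phi>(x^w Sq^k x^v). Keeping apart a factor x^w that the square does not
  touch allows squares to be moved between factors.\<close>

definition mSq :: "poly \<Rightarrow> nat \<Rightarrow> mon \<Rightarrow> mon \<Rightarrow> bit" where
  "mSq \<phi> k w v = (\<Sum>c\<in>mons5 k. of_nat (\<Prod>i<5. v i choose c i) * \<phi> (w + v + c))"

lemma DSq_eq_mSq: "DSq k \<phi> v = mSq \<phi> k 0 v"
  by (simp add: DSq_def mSq_def)

lemma sgl_mons5: "a < 5 \<Longrightarrow> sgl a t \<in> mons5 t"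
  by (simp add: mons5_def sgl_def)

lemma sgl_add: "sgl a s + sgl a t = sgl a (s + t)"
  by (auto simp: sgl_def fun_eq_iff)

text \<open>Cartan formula for the factor x_a^(2^p), on which the total square is x_a^(2^p) +
  x_a^(2^(p+1)).\<close>

lemma mSq_add_sgl:
  assumes a: "a < 5"
  shows "mSq \<phi> k w (v + sgl a (2 ^ p)) = mSq \<phi> k (w + sgl a (2 ^ p)) v +
    (if 2 ^ p \<le> k then mSq \<phi> (k - 2 ^ p) (w + sgl a (2 ^ Suc p)) v else 0)"
proof -
  define t :: nat where "t = 2 ^ p"
  define B :: "mon \<Rightarrow> bit" where "B c = of_nat (\<Prod>i<5. v i choose c i)" for c
  let ?C = "{c \<in> mons5 k. t \<le> c a}"
  have prod: "(\<Prod>i<5. f i) = f a * (\<Prod>i\<in>{..<5}-{a}. f i)" for f :: "nat \<Rightarrow> bit"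
    using a by (intro prod.remove) auto
  have "of_nat (\<Prod>i<5. (v + sgl a t) i choose c i) =
    B c + (if t \<le> c a then B (\<lambda>i. c i - sgl a t i) else 0)" for c
  proof -
    have 1: "(\<Prod>i\<in>{..<5}-{a}. of_nat ((v + sgl a t) i choose c i)) =
      (\<Prod>i\<in>{..<5}-{a}. of_nat (v i choose c i) :: bit)"
      by (rule prod.cong) (auto simp: sgl_def)
    have 2: "(\<Prod>i\<in>{..<5}-{a}. of_nat (v i choose (c i - sgl a t i))) =
      (\<Prod>i\<in>{..<5}-{a}. of_nat (v i choose c i) :: bit)"
      by (rule prod.cong) (auto simp: sgl_def)
    have 3: "(v + sgl a t) a = v a + 2 ^ p" "c a - sgl a t a = c a - 2 ^ p"
      by (simp_all add: sgl_def t_def)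
    show ?thesis
      unfolding B_def of_nat_prod prod 1 2 unfolding 3 choose_add_power_2
      by (simp add: distrib_right t_def)
  qed
  then have "mSq \<phi> k w (v + sgl a t) =
    (\<Sum>c\<in>mons5 k. (B c + (if t \<le> c a then B (\<lambda>i. c i - sgl a t i) else 0)) *
      \<phi> (w + (v + sgl a t) + c))"
    by (simp only: mSq_def)
  also have "\<dots> = (\<Sum>c\<in>mons5 k. B c * \<phi> (w + (v + sgl a t) + c)) +
    (\<Sum>c\<in>mons5 k. if t \<le> c a then B (\<lambda>i. c i - sgl a t i) * \<phi> (w + (v + sgl a t) + c) else 0)"
    unfolding sum.distrib[symmetric] by (rule sum.cong) (auto simp: distrib_right)
  also have "(\<Sum>c\<in>mons5 k. B c * \<phi> (w + (v + sgl a t) + c)) = mSq \<phi> k (w + sgl a t) v"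
    unfolding mSq_def B_def by (simp only: add.assoc add.commute[of v "sgl a t"])
  also have "(\<Sum>c\<in>mons5 k.
      if t \<le> c a then B (\<lambda>i. c i - sgl a t i) * \<phi> (w + (v + sgl a t) + c) else 0) =
    (\<Sum>c\<in>?C. B (\<lambda>i. c i - sgl a t i) * \<phi> (w + (v + sgl a t) + c))"
    by (simp only: sum.inter_filter[OF finite_mons5])
  also have "\<dots> = (if t \<le> k then mSq \<phi> (k - t) (w + sgl a (t + t)) v else 0)"
  proof (cases "t \<le> k")
    case True
    have "(\<Sum>c\<in>?C. B (\<lambda>i. c i - sgl a t i) * \<phi> (w + (v + sgl a t) + c)) =
      (\<Sum>c\<in>mons5 (k - t). B c * \<phi> (w + sgl a (t + t) + v + c))"
    proof (rule sum.reindex_bij_witness[where i = "\<lambda>c. c + sgl a t" and j = "\<lambda>c i. c i - sgl a t i"])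
      fix c assume c: "c \<in> ?C"
      show eq: "(\<lambda>i. c i - sgl a t i) + sgl a t = c"
        using c by (auto simp: fun_eq_iff sgl_def)
      have "(\<Sum>i<5. c i - sgl a t i) + (\<Sum>i<5. sgl a t i) = (\<Sum>i<5. c i)"
        unfolding sum.distrib[symmetric] using fun_cong[OF eq] by simp
      then show "(\<lambda>i. c i - sgl a t i) \<in> mons5 (k - t)"
        using c sgl_mons5[OF a, of t] by (auto simp: mons5_def)
      have "w + sgl a (t + t) + v + (\<lambda>i. c i - sgl a t i) =
        w + (v + sgl a t) + ((\<lambda>i. c i - sgl a t i) + sgl a t)"
        by (simp add: sgl_add[symmetric] ac_simps)
      then show "B (\<lambda>i. c i - sgl a t i) * \<phi> (w + sgl a (t + t) + v + (\<lambda>i. c i - sgl a t i)) =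
        B (\<lambda>i. c i - sgl a t i) * \<phi> (w + (v + sgl a t) + c)"
        unfolding eq by simp
    next
      fix c assume c: "c \<in> mons5 (k - t)"
      show "(\<lambda>i. (c + sgl a t) i - sgl a t i) = c"
        by (simp add: fun_eq_iff)
      show "c + sgl a t \<in> ?C"
        using mons5_add[OF c sgl_mons5[OF a, of t]] True by (simp add: sgl_def)
    qed
    then show ?thesis
      using True by (simp add: mSq_def B_def)
  next
    case False
    then have "?C = {}"
      using mons5_le order_trans by blast
    then show ?thesis
      using False by (simp only: sum.empty if_False)
  qed
  finally show ?thesis
    by (simp only: t_def power_Suc mult_2)
qed

text \<open>The terms of the expansion of \<open>x\<^sub>a x\<^sub>b Sq\<^sup>r v\<close>, for \<open>r = deg v\<close>, obtained by moving
  the square to the factor \<open>x\<^sub>a x\<^sub>b\<close> with the antipode of the Steenrod algebra; they telescope.\<close>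

lemma mSq_pair_eq_0:
  assumes \<phi>: "\<phi> \<in> Ker n" and ab: "a < 5" "b < 5" and v: "\<forall>i\<ge>5. v i = 0"
    and r: "\<And>p q. 2 ^ p + 2 ^ q \<noteq> r + (2::nat)"
  shows "mSq \<phi> r (sgl a 1 + sgl b 1) v = 0"
proof -
  define F where "F p q = (if 2 ^ p + 2 ^ q \<le> r + 2
    then mSq \<phi> (r + 2 - 2 ^ p - 2 ^ q) (sgl a (2 ^ p) + sgl b (2 ^ q)) v else 0)" for p q :: nat
  \<comment> \<open>This is \<phi> applied to Sq^k (x^v x_a^(2^p) x_b^(2^q)) for k = r + 2 - 2^p -
    2^q, expanded by the Cartan formula. The assumption on \<open>r\<close> excludes k = 0, so the
    kernel condition applies.\<close>
  have rel: "F p q + F (Suc p) q + (F p (Suc q) + F (Suc p) (Suc q)) = 0" for p q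
  proof (cases "2 ^ p + 2 ^ q \<le> r + 2")
    case False
    then show ?thesis
      by (simp add: F_def)
  next
    case True
    define s t :: nat where "s = 2 ^ p" and "t = 2 ^ q"
    define k where "k = r + 2 - s - t"
    have st: "s + t \<le> r + 2" "s + t \<noteq> r + 2"
      using True r by (simp_all add: s_def t_def)
    have "0 < k"
      using st by (simp add: k_def)
    moreover have "\<forall>i\<ge>5. (v + sgl a s + sgl b t) i = 0"
      using v ab by (simp add: sgl_def)
    ultimately have "0 = mSq \<phi> k 0 (v + sgl a s + sgl b t)"
      using \<phi> by (simp add: Ker_def DSq_eq_mSq)
    also have "\<dots> = mSq \<phi> k (sgl b t) (v + sgl a s) +
      (if t \<le> k then mSq \<phi> (k - t) (sgl b (t + t)) (v + sgl a s) else 0)"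
      unfolding t_def by (subst mSq_add_sgl[OF ab(2)]) (simp add: mult_2)
    also have "\<dots> = mSq \<phi> k (sgl b t + sgl a s) v +
      (if s \<le> k then mSq \<phi> (k - s) (sgl b t + sgl a (s + s)) v else 0) +
      (if t \<le> k then mSq \<phi> (k - t) (sgl b (t + t) + sgl a s) v +
        (if s \<le> k - t then mSq \<phi> (k - t - s) (sgl b (t + t) + sgl a (s + s)) v else 0) else 0)"
      unfolding s_def by (subst (1 2) mSq_add_sgl[OF ab(1)]) (simp add: mult_2)
    also have "mSq \<phi> k (sgl b t + sgl a s) v = F p q"
      using st by (simp add: F_def s_def t_def k_def add.commute)
    also have "(if s \<le> k then mSq \<phi> (k - s) (sgl b t + sgl a (s + s)) v else 0) = F (Suc p) q"
    proof -
      have "s \<le> k \<longleftrightarrow> s + s + t \<le> r + 2" "k - s = r + 2 - (s + s) - t"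
        using st by (auto simp: k_def)
      then show ?thesis
        by (simp add: F_def mult_2 s_def[symmetric] t_def[symmetric] add.commute)
    qed
    also have "(if t \<le> k then mSq \<phi> (k - t) (sgl b (t + t) + sgl a s) v +
        (if s \<le> k - t then mSq \<phi> (k - t - s) (sgl b (t + t) + sgl a (s + s)) v else 0) else 0) =
      F p (Suc q) + F (Suc p) (Suc q)"
    proof -
      have 1: "t \<le> k \<longleftrightarrow> s + (t + t) \<le> r + 2" "k - t = r + 2 - s - (t + t)"
        using st by (auto simp: k_def)
      have 2: "t \<le> k \<Longrightarrow> s \<le> k - t \<longleftrightarrow> s + s + (t + t) \<le> r + 2"
        "\<not> t \<le> k \<Longrightarrow> \<not> s + s + (t + t) \<le> r + 2" "k - t - s = r + 2 - (s + s) - (t + t)"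
        using st by (auto simp: k_def)
      have "F p (Suc q) = (if t \<le> k then mSq \<phi> (k - t) (sgl b (t + t) + sgl a s) v else 0)"
        unfolding 1 by (simp add: F_def mult_2 s_def[symmetric] t_def[symmetric] add.commute)
      moreover have "F (Suc p) (Suc q) = (if s + s + (t + t) \<le> r + 2
        then mSq \<phi> (r + 2 - (s + s) - (t + t)) (sgl b (t + t) + sgl a (s + s)) v else 0)"
        by (simp add: F_def mult_2 s_def[symmetric] t_def[symmetric] add.commute)
      ultimately show ?thesis
        using 2 by (cases "t \<le> k") auto
    qed
    finally show ?thesis
      by (simp add: add.assoc)
  qed
  have big: "r + 2 < 2 ^ (r + 2)"
    by (rule less_exp)
  have F0: "F p (r + 2) = 0" "F (r + 2) p = 0" for p
    using big by (auto simp: F_def)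
  \<comment> \<open>\<open>F\<close> vanishes once an exponent reaches r + 2. Descending induction
    on q collapses the four-term relations to two terms, and the same on p at q = 0 leaves
    \<open>F 0 0 = 0\<close>.\<close>
  have G: "F p q + F (Suc p) q = 0" if "q \<le> r + 2" for p q
    using that
  proof (induction q rule: inc_induct)
    case base
    show ?case
      by (simp only: F0 add_0)
  next
    case (step q)
    then show ?case
      using rel[of p q] by simp
  qed
  have F00: "F p 0 = 0" if "p \<le> r + 2" for p
    using that
  proof (induction p rule: inc_induct)
    case base
    show ?case
      by (simp only: F0 add_0)
  next
    case (step p)
    then show ?case
      using G[of 0 p] by simp
  qed
  have "F 0 0 = mSq \<phi> r (sgl a 1 + sgl b 1) v"
    by (simp add: F_def)
  then show ?thesis
    using F00[of 0] by simp
qed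

lemma top_choose:
  assumes "c \<in> mons5 (\<Sum>i<5. v i)" "\<forall>i\<ge>5. v i = 0" "c \<noteq> v"
  shows "(\<Prod>i<5. v i choose c i) = 0"
proof -
  have "\<exists>i<5. v i < c i"
  proof (rule ccontr)
    assume "\<not> ?thesis"
    then have le: "c i \<le> v i" if "i \<in> {..<5}" for i
      using that by force
    have "c i = v i" if "i < 5" for i
      using sum_mono_inv[of c "{..<5}" v] le assms(1) that by (simp add: mons5_def)
    then have "c = v"
      using assms(1,2) by (auto simp: fun_eq_iff mons5_def) (metis not_less)
    then show False
      using assms(3) by simp
  qed
  then show ?thesis
    by (auto simp: prod_zero_iff intro: binomial_eq_0)
qed

text \<open>The top square of a monomial is its ordinary square, since every other increment of the
  same total size exceeds \<open>v\<close> somewhere.\<close>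

lemma mSq_top:
  assumes "\<forall>i\<ge>5. v i = 0"
  shows "mSq \<phi> (\<Sum>i<5. v i) w v = \<phi> (w + v + v)"
proof -
  let ?r = "\<Sum>i<5. v i"
  have v: "v \<in> mons5 ?r"
    using assms by (simp add: mons5_def)
  have "mSq \<phi> ?r w v = (\<Sum>c\<in>mons5 ?r. if c = v then \<phi> (w + v + v) else 0)"
    unfolding mSq_def by (rule sum.cong) (auto simp: top_choose[OF _ assms] simp del: of_nat_prod)
  then show ?thesis
    using v by (simp add: finite_mons5)
qed

definition deg :: "nat \<Rightarrow> nat" where
  "deg d = 4 * (2 ^ d - 1)"

lemma deg_Suc: "deg (Suc d) = 4 + 2 * deg d"
proof -
  have "(1::nat) \<le> 2 ^ d"
    by simp
  then show ?thesis
    by (simp add: deg_def diff_mult_distrib2)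
qed

text \<open>The right side is odd, so one power is 1 and the other equals 2 (2^e - 1); but 2^e - 1
  is odd and exceeds 1.\<close>

lemma not_sum_two_powers:
  assumes "1 < e"
  shows "2 ^ p + 2 ^ q \<noteq> (2::nat) ^ Suc e - 1"
proof
  assume eq: "2 ^ p + 2 ^ q = (2::nat) ^ Suc e - 1"
  have "(2::nat) ^ 2 \<le> 2 ^ e"
    using assms by (intro power_increasing) auto
  then have e: "4 \<le> (2::nat) ^ e"
    by simp
  have *: False if "1 + 2 ^ q = (2::nat) ^ Suc e - 1" for q
  proof (cases q)
    case (Suc q')
    have q': "(2::nat) ^ q' + 1 = 2 ^ e"
      using that Suc e by simp
    then show False
    proof (cases q')
      case (Suc q'')
      have "even ((2::nat) ^ e)"
        using assms by simp
      then show False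
        using q' Suc by (metis even_add even_power odd_one zero_less_Suc even_numeral)
    qed (use e in simp)
  qed (use that e in simp)
  have "odd ((2::nat) ^ Suc e - 1)"
    by simp
  then have "odd ((2::nat) ^ p) \<or> odd ((2::nat) ^ q)"
    unfolding eq[symmetric] by auto
  then have "p = 0 \<or> q = 0"
    by (cases "p = 0") auto
  then show False
    using * eq by (auto simp: add.commute)
qed

section \<open>Iterating the recursion\<close>

text \<open>As the degree is even, 0 or 2 odd exponents have to be excluded. A square is the top
  square of its root. In x_i x_j y^2 the factor y^2 is the top square Sq^r y with r + 2 = 2^(d+2) -
  1, so \<open>mSq_pair_eq_0\<close> applies; this uses d > 0.\<close>

lemma odd4_Ker:
  assumes d: "0 < d" and \<phi>: "\<phi> \<in> Ker (deg (Suc d))"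
  shows "odd4 \<phi>"
  unfolding odd4_def
proof (intro allI impI, rule ccontr)
  fix E b assume E: "E \<subseteq> {..<5}" "card E \<noteq> 4" and nz: "\<phi> (en E b) \<noteq> 0"
  let ?r = "\<Sum>i<5. b i"
  have "en E b \<in> mons5 (deg (Suc d))"
    using nz Ker_P5[OF \<phi>] by (auto simp: P5_def)
  then have b: "\<forall>i\<ge>5. b i = 0" and sum: "card E + 2 * ?r = deg (Suc d)"
    by (simp_all add: en_mons5[OF E(1)])
  have "even (card E + 2 * ?r)"
    unfolding sum deg_def by simp
  then have "even (card E)"
    by simp
  then obtain c where "card E = 2 * c"
    by (elim evenE)
  then consider "card E = 0" | "card E = 2"
    using E(2) card_subset5[OF E(1)] by (cases "c = 0 \<or> c = 1") auto
  then show False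
  proof cases
    case 1
    then have "E = {}"
      using finite_subset5[OF E(1)] by simp
    have "0 < ?r"
      using sum 1 by (simp add: deg_Suc)
    then have "0 = mSq \<phi> ?r 0 b"
      using \<phi> b unfolding DSq_eq_mSq[symmetric] by (simp add: Ker_def)
    also have "\<dots> = \<phi> (0 + b + b)"
      by (rule mSq_top[OF b])
    also have "0 + b + b = en E b"
      unfolding \<open>E = {}\<close> by (simp add: en_def fun_eq_iff)
    finally show False
      using nz by simp
  next
    case 2
    then obtain x y where xy: "E = {x, y}" "x \<noteq> y"
      by (auto simp: card_2_iff)
    have le: "(2::nat) \<le> 2 ^ Suc (Suc d)"
      by simp
    have "deg (Suc d) + 4 = 2 * 2 ^ Suc (Suc d)"
      using le by (simp add: deg_def diff_mult_distrib2)
    then have r2: "?r + 2 = 2 ^ Suc (Suc d) - 1"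
      using sum 2 le by linarith
    have "2 ^ p + 2 ^ q \<noteq> ?r + (2::nat)" for p q
      unfolding r2 by (rule not_sum_two_powers) (use d in simp)
    then have "0 = mSq \<phi> ?r (sgl x 1 + sgl y 1) b"
      using mSq_pair_eq_0[OF \<phi>, of x y b ?r] xy E(1) b by simp
    also have "\<dots> = \<phi> (sgl x 1 + sgl y 1 + b + b)"
      by (rule mSq_top[OF b])
    also have "sgl x 1 + sgl y 1 + b + b = en E b"
      unfolding xy(1) using xy(2) by (auto simp: en_def sgl_def fun_eq_iff)
    finally show False
      using nz by simp
  qed
qed

lemma Ker_deg_Suc:
  assumes "0 < d" "\<phi> \<in> P5 (deg (Suc d))" "odd4 \<phi>"
  shows "\<phi> \<in> Ker (deg (Suc d)) \<longleftrightarrow> (\<forall>j<5. part \<phi> j \<in> Ker (deg d)) \<and> contract (part \<phi>)"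
  using Ker_rec[of \<phi> "deg d"] assms unfolding deg_Suc by blast

lemma Ker_part:
  assumes "\<phi> \<in> Ker (deg (Suc (Suc d)))"
  shows "j < 5 \<Longrightarrow> part \<phi> j \<in> Ker (deg (Suc d))" and "contract (part \<phi>)"
  using Ker_deg_Suc[of "Suc d" \<phi>] odd4_Ker[of "Suc d" \<phi>] Ker_P5[OF assms] assms by auto

lemma contract_cong:
  assumes "\<And>j. j < 5 \<Longrightarrow> \<psi> j = \<chi> j"
  shows "contract \<psi> \<longleftrightarrow> contract \<chi>"
  using assms by (simp add: contract_def)

lemma P5_outside: "\<phi> \<in> P5 n \<Longrightarrow> \<not> (\<forall>i\<ge>5. b i = 0) \<Longrightarrow> \<phi> b = 0"
  by (auto simp: P5_def mons5_def)

text \<open>The contraction is tested on x_E y^2. Multiplication by x_j adds j to \<open>E\<close>,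
  or removes it and enlarges the squared part. Four odd exponents therefore arise only if
  \<open>E\<close> has three elements, from the two missing variables, or five, from every variable:
  the former case is the symmetry, the latter the contraction of the diagonal.\<close>

lemma contract_odd4:
  assumes o: "\<And>j. j < 5 \<Longrightarrow> odd4 (\<psi> j)" and P: "\<And>j. j < 5 \<Longrightarrow> \<psi> j \<in> P5 (4 + 2 * m)"
  shows "contract \<psi> \<longleftrightarrow>
    (\<forall>j<5. \<forall>k<5. part (\<psi> j) k = part (\<psi> k) j) \<and> contract (\<lambda>j. part (\<psi> j) j)"
proof -
  define S where "S E v = (\<Sum>j<5. \<psi> j (en E v + ind {j}))" for E v
  have term_0: "\<psi> j (en E v + ind {j}) = 0"
    if "E \<subseteq> {..<5}" "j < 5" "j \<in> E \<Longrightarrow> card E \<noteq> 5" "j \<notin> E \<Longrightarrow> card E \<noteq> 3" for j v and E :: "nat set"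
  proof (cases "j \<in> E")
    case True
    then show ?thesis
      unfolding en_add_ind using that finite_subset5[OF that(1)]
      by (auto intro!: odd4D[OF o] simp: card_Diff_singleton)
  next
    case False
    then show ?thesis
      unfolding en_add_ind using that finite_subset5[OF that(1)]
      by (auto intro!: odd4D[OF o])
  qed
  have S5: "S {..<5} v = (\<Sum>j<5. part (\<psi> j) j (v + ind {j}))" for v
    unfolding S_def en_add_ind part_def by (rule sum.cong) auto
  have S3: "S ({..<5} - {j, k}) v = part (\<psi> j) k v + part (\<psi> k) j v"
    if "j < 5" "k < 5" "j \<noteq> k" for j k v
  proof -
    let ?E = "{..<5} - {j, k}"
    have "card ?E = 3"
      using that by (simp add: card_Diff_subset)
    then have "S ?E v = (\<Sum>i\<in>{j, k}. \<psi> i (en ?E v + ind {i}))"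
      unfolding S_def using that by (intro sum.mono_neutral_right) (auto intro!: term_0)
    also have "\<dots> = \<psi> j (en (insert j ?E) v) + \<psi> k (en (insert k ?E) v)"
      using that by (simp add: en_add_ind)
    also have "insert j ?E = {..<5} - {k}"
      using that by auto
    also have "insert k ?E = {..<5} - {j}"
      using that by auto
    finally show ?thesis
      by (simp add: part_def)
  qed
  have S_0: "S E v = 0" if "E \<subseteq> {..<5}" "card E \<noteq> 5" "card E \<noteq> 3" for E :: "nat set" and v
    unfolding S_def using that by (intro sum.neutral) (auto intro!: term_0)
  have sub3: "\<exists>j k. j < 5 \<and> k < 5 \<and> j \<noteq> k \<and> E = {..<5} - {j, k}" if "E \<subseteq> {..<5}" "card E = 3" for E :: "nat set"
  proof -
    have "card ({..<5} - E) = 2"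
      using that finite_subset5[OF that(1)] by (simp add: card_Diff_subset)
    then obtain j k where "{..<5} - E = {j, k}" "j \<noteq> k"
      by (auto simp: card_2_iff)
    moreover from this have "E = {..<5} - {j, k}"
      using that(1) by auto
    ultimately show ?thesis
      by auto
  qed
  have "contract \<psi> \<longleftrightarrow> (\<forall>E v. E \<subseteq> {..<5} \<longrightarrow> (\<forall>i\<ge>5. v i = 0) \<longrightarrow> S E v = 0)"
  proof
    assume c: "contract \<psi>"
    show "\<forall>E v. E \<subseteq> {..<5} \<longrightarrow> (\<forall>i\<ge>5. v i = 0) \<longrightarrow> S E v = 0"
    proof (intro allI impI)
      fix E :: "nat set" and v :: mon assume "E \<subseteq> {..<5}" "\<forall>i\<ge>5. v i = 0"
      then have "\<forall>i\<ge>5. en E v i = 0"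
        by (auto simp: en_def)
      then show "S E v = 0"
        using c by (simp add: contract_def S_def)
    qed
  next
    assume r: "\<forall>E v. E \<subseteq> {..<5} \<longrightarrow> (\<forall>i\<ge>5. v i = 0) \<longrightarrow> S E v = 0"
    show "contract \<psi>"
      unfolding contract_def
    proof (intro allI impI)
      fix a :: mon assume a: "\<forall>i\<ge>5. a i = 0"
      obtain E b where ab: "a = en E b"
        using en_decomp by blast
      have z: "(if i \<in> E then 1 else 0) + 2 * b i = (0::nat)" if "5 \<le> i" for i
        using a that unfolding ab en_def by simp
      have "E \<subseteq> {..<5}"
      proof
        fix i assume "i \<in> E"
        then show "i \<in> {..<5}"
          using z[of i] by (cases "i < 5") auto
      qed
      moreover have "\<forall>i\<ge>5. b i = 0"
        using z by auto
      ultimately have "S E b = 0"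
        using r by blast
      then show "(\<Sum>j<5. \<psi> j (a + ind {j})) = 0"
        by (simp add: S_def ab)
    qed
  qed
  also have "\<dots> \<longleftrightarrow> (\<forall>j<5. \<forall>k<5. part (\<psi> j) k = part (\<psi> k) j) \<and> contract (\<lambda>j. part (\<psi> j) j)"
  proof (intro iffI conjI allI impI)
    assume r: "\<forall>E v. E \<subseteq> {..<5} \<longrightarrow> (\<forall>i\<ge>5. v i = 0) \<longrightarrow> S E v = 0"
    show "part (\<psi> j) k = part (\<psi> k) j" if jk: "j < 5" "k < 5" for j k
    proof
      fix v
      have out: "part (\<psi> i) l v = 0" if "\<not> (\<forall>i\<ge>5. v i = 0)" "i < 5" "l < 5" for i l
        by (rule P5_outside[OF part_P5[OF P[OF that(2)] that(3)] that(1)])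
      show "part (\<psi> j) k v = part (\<psi> k) j v"
      proof -
        consider "j = k" | "\<forall>i\<ge>5. v i = 0" "j \<noteq> k" | "\<not> (\<forall>i\<ge>5. v i = 0)"
          by blast
        then show ?thesis
        proof cases
          case 2
          then have "S ({..<5} - {j, k}) v = 0"
            using r by simp
          then show ?thesis
            using S3[OF jk 2(2)] by simp
        next
          case 3
          show ?thesis
            unfolding out[OF 3 jk] out[OF 3 jk(2) jk(1)] ..
        qed simp
      qed
    qed
    show "contract (\<lambda>j. part (\<psi> j) j)"
      using r unfolding contract_def S5[symmetric] by simp
  next
    fix E :: "nat set" and v :: mon
    assume r: "(\<forall>j<5. \<forall>k<5. part (\<psi> j) k = part (\<psi> k) j) \<and> contract (\<lambda>j. part (\<psi> j) j)"
      and E: "E \<subseteq> {..<5}" and v: "\<forall>i\<ge>5. v i = (0::nat)"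
    consider "card E = 3" | "card E = 5" | "card E \<noteq> 3" "card E \<noteq> 5"
      by blast
    then show "S E v = 0"
    proof cases
      case 1
      then obtain j k where jk: "j < 5" "k < 5" "j \<noteq> k" "E = {..<5} - {j, k}"
        using sub3[OF E] by blast
      then have "part (\<psi> j) k = part (\<psi> k) j"
        using r by blast
      then show ?thesis
        unfolding jk(4) S3[OF jk(1-3)] by simp
    next
      case 2
      then have "E = {..<5}"
        using card_subset_eq[OF _ E] by simp
      then show ?thesis
        using r v by (simp add: contract_def S5)
    next
      case 3
      then show ?thesis
        using S_0 E by blast
    qed
  qed
  finally show ?thesis .
qed

lemma contract_Ker:
  assumes "\<And>j. j < 5 \<Longrightarrow> \<psi> j \<in> Ker (deg (Suc (Suc d)))"
  shows "contract \<psi> \<longleftrightarrow>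
    (\<forall>j<5. \<forall>k<5. part (\<psi> j) k = part (\<psi> k) j) \<and> contract (\<lambda>j. part (\<psi> j) j)"
proof (rule contract_odd4)
  show "odd4 (\<psi> j)" if "j < 5" for j
    using odd4_Ker[of "Suc d"] assms that by simp
  show "\<psi> j \<in> P5 (4 + 2 * deg (Suc d))" if "j < 5" for j
    using Ker_P5[OF assms[OF that]] by (simp add: deg_Suc)
qed

section \<open>Iterated parts, indexed by words\<close>

definition wds :: "nat \<Rightarrow> nat list set" where
  "wds s = {w. set w \<subseteq> {..<5} \<and> length w = s}"

fun peel :: "poly \<Rightarrow> nat list \<Rightarrow> poly" where
  "peel \<phi> [] = \<phi>"
| "peel \<phi> (j # w) = peel (part \<phi> j) w"

lemma peel_append: "peel \<phi> (u @ w) = peel (peel \<phi> u) w"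
  by (induction u arbitrary: \<phi>) auto

lemma wds_0 [simp]: "w \<in> wds 0 \<longleftrightarrow> w = []"
  by (auto simp: wds_def)

lemma wds_Cons [simp]: "j # w \<in> wds (Suc s) \<longleftrightarrow> j < 5 \<and> w \<in> wds s"
  by (auto simp: wds_def)

lemma wds_append: "u \<in> wds s \<Longrightarrow> w \<in> wds t \<Longrightarrow> u @ w \<in> wds (s + t)"
  by (auto simp: wds_def)

lemma wds_replicate: "j < 5 \<Longrightarrow> replicate s j \<in> wds s"
  by (auto simp: wds_def)

lemma wds_SucE:
  assumes "w \<in> wds (Suc s)"
  obtains j u where "w = j # u" "j < 5" "u \<in> wds s"
  using assms by (cases w) (auto simp: wds_def)

text \<open>An enumeration of \<open>T\<close> is padded to length \<open>s\<close> by repeating one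
  of its letters.\<close>

lemma ex_wd:
  assumes "T \<subseteq> {..<5}" "T \<noteq> {}" "card T \<le> s"
  shows "\<exists>w\<in>wds s. set w = T"
proof -
  obtain xs where xs: "set xs = T" "distinct xs"
    using finite_distinct_list[OF finite_subset5[OF assms(1)]] by blast
  obtain a where a: "a \<in> T"
    using assms(2) by blast
  have "length xs = card T"
    using xs distinct_card by fastforce
  then have "xs @ replicate (s - length xs) a \<in> wds s"
    using xs a assms by (auto simp: wds_def)
  moreover have "set (xs @ replicate (s - length xs) a) = T"
    using xs a by auto
  ultimately show ?thesis
    by blast
qed

lemma Ker_peel:
  assumes "w \<in> wds t" "\<phi> \<in> Ker (deg (Suc (s + t)))"
  shows "peel \<phi> w \<in> Ker (deg (Suc s))"
  using assms
proof (induction t arbitrary: w \<phi>)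
  case (Suc t)
  then obtain j u where w: "w = j # u" "j < 5" "u \<in> wds t"
    by (elim wds_SucE)
  have "part \<phi> j \<in> Ker (deg (Suc (s + t)))"
    using Ker_part(1)[of \<phi> "s + t" j] Suc.prems w by simp
  then show ?case
    using Suc.IH w by simp
qed simp

text \<open>Kernel elements vanish off four odd exponents and are therefore determined by their
  parts, inductively by their iterated parts.\<close>

lemma peel_inject:
  assumes "\<phi> \<in> Ker (deg (Suc s))" "\<psi> \<in> Ker (deg (Suc s))"
    and "\<And>w. w \<in> wds s \<Longrightarrow> peel \<phi> w = peel \<psi> w"
  shows "\<phi> = \<psi>"
  using assms
proof (induction s arbitrary: \<phi> \<psi>)
  case 0
  then show ?case
    using 0(3)[of "[]"] by simp
next
  case (Suc s)
  have "part \<phi> j = part \<psi> j" if j: "j < 5" for j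
  proof (rule Suc.IH)
    show "peel (part \<phi> j) w = peel (part \<psi> j) w" if "w \<in> wds s" for w
      using Suc.prems(3)[of "j # w"] j that by simp
  qed (use Ker_part(1) Suc.prems j in auto)
  then show ?case
    using Suc.prems(1,2) by (intro odd4_eqI[of \<phi> \<psi>]) (auto intro: odd4_Ker[of "Suc s"] Ker_P5)
qed

text \<open>By induction the letters after the first matter only through their set, so the first
  letter remains to be treated. Symmetry of the parts exchanges the first two letters
  (\<open>swap\<close>); symmetry after one passage to the diagonal gives jju... its second
  relation, jjk = kkj (\<open>jjk\<close>).\<close>

lemma peel_set_dep:
  assumes "\<phi> \<in> Ker (deg (Suc s))" "w \<in> wds s" "w' \<in> wds s" "set w = set w'"
  shows "peel \<phi> w = peel \<phi> w'"
  using assms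
proof (induction s arbitrary: \<phi> w w')
  case 0
  then show ?case
    by simp
next
  case (Suc s)
  define g where "g j = peel (part \<phi> j)" for j
  have K: "part \<phi> j \<in> Ker (deg (Suc s))" if "j < 5" for j
    using Ker_part(1)[OF Suc.prems(1) that] .
  have dep: "g j x = g j y" if "j < 5" "x \<in> wds s" "y \<in> wds s" "set x = set y" for j x y
    unfolding g_def using Suc.IH[OF K] that by blast
  have swap: "g j (k # u) = g k (j # u)" if "s = Suc t" "j < 5" "k < 5" "u \<in> wds t" for j k t u
    using contract_Ker[of "part \<phi>" t] K Ker_part(2)[OF Suc.prems(1)] that unfolding g_def by simp
  have jjk: "g j (j # k # u) = g k (k # j # u)"
    if s: "s = Suc (Suc t)" and jk: "j < 5" "k < 5" and u: "u \<in> wds t" for j k t u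
  proof -
    have K2: "part (part \<phi> i) i \<in> Ker (deg (Suc (Suc t)))" if "i < 5" for i
      using Ker_part(1)[of "part \<phi> i" "Suc t" i] K[OF that] that s by simp
    have "contract (\<lambda>i. part (part \<phi> i) i)"
      using contract_Ker[of "part \<phi>" "Suc t"] K Ker_part(2)[OF Suc.prems(1)] s by simp
    then have "part (part (part \<phi> j) j) k = part (part (part \<phi> k) k) j"
      using contract_Ker[of "\<lambda>i. part (part \<phi> i) i" t, OF K2] jk by blast
    then show ?thesis
      by (simp add: g_def)
  qed
  \<comment> \<open>On words the chain is jkk = kjk = kkj = jjk, so the leading j may also be added
    to the tail. A repetition to be sacrificed exists because \<open>y\<close> has the same length
    as \<open>x\<close> and one more distinct letter.\<close>
  have add: "g j x = g j y"
    if j: "j < 5" and x: "x \<in> wds s" and y: "y \<in> wds s" and xy: "j \<notin> set x" "set y = insert j (set x)"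
    for j x y
  proof -
    have ne: "set x \<noteq> {}"
      using x y xy(2) by (cases s) (auto elim!: wds_SucE)
    have "Suc (card (set x)) = card (set y)"
      using xy by simp
    also have "\<dots> \<le> s"
      using y card_length[of y] by (simp add: wds_def)
    finally have card: "Suc (card (set x)) \<le> s" .
    moreover have "0 < card (set x)"
      using ne by (simp add: card_gt_0_iff)
    ultimately obtain t where t: "s = Suc (Suc t)"
      by (metis Suc_le_D Suc_le_mono gr0_implies_Suc)
    then obtain z where z: "z \<in> wds (Suc t)" "set z = set x"
      using ex_wd[of "set x" "Suc t"] x card ne by (auto simp: wds_def)
    then obtain k u where ku: "z = k # u" "k < 5" "u \<in> wds t"
      by (elim wds_SucE)
    have "g j x = g j (k # k # u)"
      using j x ku z t by (intro dep) auto
    also have "\<dots> = g k (j # k # u)"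
      using swap t j ku by simp
    also have "\<dots> = g k (k # j # u)"
      using j ku t by (intro dep) auto
    also have "\<dots> = g j (j # k # u)"
      using jjk[OF t] j ku by simp
    also have "\<dots> = g j y"
      using j ku y t xy z by (intro dep) auto
    finally show ?thesis .
  qed
  have same: "g j x = g j y"
    if "j < 5" "x \<in> wds s" "y \<in> wds s" "insert j (set x) = insert j (set y)" for j x y
  proof (cases "j \<in> set x"; cases "j \<in> set y")
    assume "j \<in> set x" "j \<in> set y"
    then show ?thesis
      using that by (intro dep) auto
  next
    assume "j \<in> set x" "j \<notin> set y"
    then show ?thesis
      using add[of j y x] that by (simp add: insert_absorb)
  next
    assume "j \<notin> set x" "j \<in> set y"
    then show ?thesis
      using add[of j x y] that by (simp add: insert_absorb)
  next
    assume "j \<notin> set x" "j \<notin> set y"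
    then have "set x = set y"
      using that(4) by (simp add: insert_ident)
    then show ?thesis
      using that by (intro dep)
  qed
  obtain j x where w: "w = j # x" "j < 5" "x \<in> wds s"
    using Suc.prems(2) by (elim wds_SucE)
  obtain k y where w': "w' = k # y" "k < 5" "y \<in> wds s"
    using Suc.prems(3) by (elim wds_SucE)
  have S: "insert j (set x) = insert k (set y)"
    using Suc.prems(4) w w' by simp
  have "g j x = g k y"
  proof (cases "j = k")
    case True
    with S have eq: "insert j (set x) = insert j (set y)"
      by (simp only:)
    show ?thesis
      unfolding True[symmetric] by (rule same[OF w(2,3) w'(3) eq])
  next
    case False
    have "k \<in> insert j (set x)"
      unfolding S by (rule insertI1)
    then have "k \<in> set x"
      using False by simp
    then obtain a b where ab: "x = a @ k # b"
      by (auto simp: in_set_conv_decomp)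
    obtain t where t: "s = Suc t"
      using w(3) ab by (cases s) auto
    have u: "a @ b \<in> wds t"
      using w(3) ab t by (auto simp: wds_def)
    have "g j x = g j (k # a @ b)"
      using w u t w'(2) ab by (intro dep) auto
    also have "\<dots> = g k (j # a @ b)"
      using swap t w w' u by simp
    also have "\<dots> = g k y"
    proof (rule same)
      have "insert k (set (j # a @ b)) = insert j (set x)"
        using ab by auto
      then show "insert k (set (j # a @ b)) = insert k (set y)"
        using S by (simp only:)
    qed (use w w' u t in auto)
    finally show ?thesis .
  qed
  then show ?case
    by (simp add: w w' g_def)
qed

lemma contract_congI:
  assumes "contract \<chi>" "\<And>j. j < 5 \<Longrightarrow> \<psi> j = \<chi> j"
  shows "contract \<psi>"
  by (rule iffD2[OF contract_cong assms(1)]) (rule assms(2))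

text \<open>Since only the set of letters matters, the contracted letter can be moved past the fixed
  prefix until it is the innermost one.\<close>

lemma contract_peel_Cons:
  assumes "\<phi> \<in> Ker (deg (Suc (Suc t)))" "u \<in> wds t"
  shows "contract (\<lambda>j. peel \<phi> (j # u))"
  using assms
proof (induction t arbitrary: \<phi> u)
  case 0
  have "(\<lambda>j. peel \<phi> (j # u)) = part \<phi>"
    using 0(2) by auto
  then show ?case
    using Ker_part(2)[OF 0(1)] by simp
next
  case (Suc t)
  then obtain a v where u: "u = a # v" "a < 5" "v \<in> wds t"
    by (elim wds_SucE)
  show ?case
  proof (rule contract_congI)
    show "contract (\<lambda>j. peel (part \<phi> a) (j # v))"
      by (rule Suc.IH[OF Ker_part(1)[OF Suc.prems(1) u(2)] u(3)])
    show "peel \<phi> (j # u) = peel (part \<phi> a) (j # v)" if "j < 5" for j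
      using peel_set_dep[OF Suc.prems(1), of "j # a # v" "a # j # v"] u that
      by (simp add: insert_commute)
  qed
qed

lemma contract_peel_replicate:
  assumes "\<And>j. j < 5 \<Longrightarrow> \<psi> j \<in> Ker (deg (Suc s))" "contract \<psi>"
  shows "contract (\<lambda>j. peel (\<psi> j) (replicate s j))"
  using assms
proof (induction s arbitrary: \<psi>)
  case (Suc s)
  have "contract (\<lambda>j. part (\<psi> j) j)"
    using contract_Ker[of \<psi> s] Suc.prems by blast
  then have "contract (\<lambda>j. peel (part (\<psi> j) j) (replicate s j))"
    using Suc.prems(1) by (intro Suc.IH) (auto intro: Ker_part)
  then show ?case
    by simp
qed simp

text \<open>Intrinsic description of the families of iterated parts of kernel elements. Constant
  words need their own condition: it is the contraction at the empty set, which is not the letter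
  set of any word of positive length.\<close>

definition word_system :: "nat \<Rightarrow> (nat list \<Rightarrow> poly) \<Rightarrow> bool" where
  "word_system s f \<longleftrightarrow> (\<forall>w\<in>wds s. f w \<in> Ker 4) \<and>
    (\<forall>w\<in>wds s. \<forall>w'\<in>wds s. set w = set w' \<longrightarrow> f w = f w') \<and>
    (\<forall>t. s = Suc t \<longrightarrow> (\<forall>u\<in>wds t. contract (\<lambda>j. f (j # u))) \<and>
      contract (\<lambda>j. f (replicate s j)))"

lemma word_systemD:
  assumes "word_system s f"
  shows "w \<in> wds s \<Longrightarrow> f w \<in> Ker 4"
    and "w \<in> wds s \<Longrightarrow> w' \<in> wds s \<Longrightarrow> set w = set w' \<Longrightarrow> f w = f w'"
    and "s = Suc t \<Longrightarrow> u \<in> wds t \<Longrightarrow> contract (\<lambda>j. f (j # u))"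
    and "s = Suc t \<Longrightarrow> contract (\<lambda>j. f (replicate s j))"
proof -
  note * = assms[unfolded word_system_def]
  show "w \<in> wds s \<Longrightarrow> f w \<in> Ker 4"
    by (rule *[THEN conjunct1, rule_format])
  show "w \<in> wds s \<Longrightarrow> w' \<in> wds s \<Longrightarrow> set w = set w' \<Longrightarrow> f w = f w'"
    by (rule *[THEN conjunct2, THEN conjunct1, rule_format])
  have 3: "s = Suc t \<Longrightarrow> (\<forall>u\<in>wds t. contract (\<lambda>j. f (j # u))) \<and>
      contract (\<lambda>j. f (replicate s j))"
    by (rule *[THEN conjunct2, THEN conjunct2, rule_format])
  show "s = Suc t \<Longrightarrow> u \<in> wds t \<Longrightarrow> contract (\<lambda>j. f (j # u))"
    by (rule 3[THEN conjunct1, rule_format])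
  show "s = Suc t \<Longrightarrow> contract (\<lambda>j. f (replicate s j))"
    by (rule 3[THEN conjunct2])
qed

lemma deg_1: "deg (Suc 0) = 4"
  by (simp add: deg_def)

lemma word_system_peel:
  assumes "\<phi> \<in> Ker (deg (Suc s))"
  shows "word_system s (peel \<phi>)"
  unfolding word_system_def
proof (intro conjI ballI allI impI)
  show "peel \<phi> w \<in> Ker 4" if "w \<in> wds s" for w
    using Ker_peel[OF that, of \<phi> 0] assms by (simp add: deg_1)
  show "peel \<phi> w = peel \<phi> w'" if "w \<in> wds s" "w' \<in> wds s" "set w = set w'" for w w'
    using peel_set_dep[OF assms] that by blast
  fix t assume s: "s = Suc t"
  show "contract (\<lambda>j. peel \<phi> (j # u))" if "u \<in> wds t" for u
    using contract_peel_Cons[of \<phi> t u] assms that s by simp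
  show "contract (\<lambda>j. peel \<phi> (replicate s j))"
    using contract_peel_replicate[of "part \<phi>" t] Ker_part[of \<phi> t] assms s by simp
qed

text \<open>The words beginning with j give a shorter system, realised by \<phi> j; gluing these
  needs \<open>contract \<phi>\<close>. This is obtained by descending induction on the number i of
  equal letters peeled off, from the condition on constant words at i = s to i = 0, each step
  recovering a contraction from that of the diagonal together with symmetry.\<close>

lemma word_system_realised:
  assumes "word_system s f"
  shows "\<exists>\<phi>\<in>Ker (deg (Suc s)). \<forall>w\<in>wds s. peel \<phi> w = f w"
  using assms
proof (induction s arbitrary: f)
  case 0
  show ?case
    using word_systemD(1)[OF 0, of "[]"] by (intro bexI[of _ "f []"]) (simp_all add: deg_1)
next
  case (Suc s)
  note K = word_systemD(1)[OF Suc.prems]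
  note dep = word_systemD(2)[OF Suc.prems]
  note con = word_systemD(3)[OF Suc.prems refl]
  have "word_system s (\<lambda>w. f (j # w))" if j: "j < 5" for j
    unfolding word_system_def
  proof (intro conjI ballI allI impI)
    show "f (j # w) \<in> Ker 4" if "w \<in> wds s" for w
      using K j that by simp
    show "f (j # w) = f (j # w')" if "w \<in> wds s" "w' \<in> wds s" "set w = set w'" for w w'
      using j that by (intro dep) auto
    fix t assume s: "s = Suc t"
    show "contract (\<lambda>k. f (j # k # u))" if u: "u \<in> wds t" for u
    proof -
      have "j # u \<in> wds s"
        using j u s by simp
      then show ?thesis
      proof (rule contract_congI[OF con])
        show "f (j # k # u) = f (k # j # u)" if "k < 5" for k
          using j u s that by (intro dep) auto
      qed
    qed
    have "f (j # replicate s k) = f (k # replicate s j)" if "k < 5" for k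
    proof (rule dep)
      have "set (replicate s i) = {i}" for i :: nat
        by (rule set_replicate) (simp add: s)
      then have "set (j # replicate s k) = {j, k}" "set (k # replicate s j) = {k, j}"
        by simp_all
      then show "set (j # replicate s k) = set (k # replicate s j)"
        by (simp only: insert_commute)
    qed (use j that wds_replicate in auto)
    then show "contract (\<lambda>k. f (j # replicate s k))"
      by (rule contract_congI[OF con[OF wds_replicate[OF j]]])
  qed
  then have "\<forall>j. \<exists>\<phi>. j < 5 \<longrightarrow> \<phi> \<in> Ker (deg (Suc s)) \<and> (\<forall>w\<in>wds s. peel \<phi> w = f (j # w))"
    using Suc.IH by blast
  then obtain \<phi> where \<phi>: "\<And>j. j < 5 \<Longrightarrow> \<phi> j \<in> Ker (deg (Suc s))"
    and peel: "\<And>j w. j < 5 \<Longrightarrow> w \<in> wds s \<Longrightarrow> peel (\<phi> j) w = f (j # w)"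
    by metis
  have "contract (\<lambda>j. peel (\<phi> j) (replicate i j))" if "i \<le> s" for i
    using that
  proof (induction i rule: inc_induct)
    case base
    have "contract (\<lambda>j. f (j # replicate s j))"
      using word_systemD(4)[OF Suc.prems refl] by (simp only: replicate_Suc)
    then show ?case
      by (rule contract_congI) (simp add: peel wds_replicate)
  next
    case (step i)
    define \<chi> where "\<chi> j = peel (\<phi> j) (replicate i j)" for j
    have d: "s = Suc (s - Suc i) + i"
      using step(2) by simp
    define d where "d = s - Suc i"
    note d = d[folded d_def]
    have \<chi>: "\<chi> j \<in> Ker (deg (Suc (Suc d)))" if "j < 5" for j
      unfolding \<chi>_def using \<phi>[OF that] d by (intro Ker_peel[OF wds_replicate[OF that]]) simp
    \<comment> \<open>Both sides are compared after peeling off all remaining letters, where they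
      become values of f at two words with the same set of letters.\<close>
    have "part (\<chi> j) k = part (\<chi> k) j" if jk: "j < 5" "k < 5" for j k
    proof (rule peel_inject)
      show "part (\<chi> j) k \<in> Ker (deg (Suc d))" "part (\<chi> k) j \<in> Ker (deg (Suc d))"
        by (rule Ker_part(1)[OF \<chi>[OF jk(1)] jk(2)], rule Ker_part(1)[OF \<chi>[OF jk(2)] jk(1)])
      fix w assume w: "w \<in> wds d"
      have *: "peel (part (\<chi> j) k) w = f (j # replicate i j @ k # w) \<and>
          j # replicate i j @ k # w \<in> wds (Suc s)" if "j < 5" "k < 5" for j k
      proof -
        have "k # w \<in> wds (Suc d)"
          using that w by simp
        from wds_append[OF wds_replicate[OF that(1)] this, of i]
        have W: "replicate i j @ k # w \<in> wds s"
          unfolding d by (simp only: add.commute)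
        have "peel (part (\<chi> j) k) w = peel (\<phi> j) (replicate i j @ k # w)"
          by (simp add: \<chi>_def peel_append)
        then show ?thesis
          unfolding peel[OF that(1) W, symmetric] using W that by simp
      qed
      show "peel (part (\<chi> j) k) w = peel (part (\<chi> k) j) w"
        unfolding *[OF jk, THEN conjunct1] *[OF jk(2,1), THEN conjunct1]
      proof (rule dep)
        show "set (j # replicate i j @ k # w) = set (k # replicate i k @ j # w)"
          by auto
      qed (use *[OF jk] *[OF jk(2,1)] in blast)+
    qed
    then have sym: "\<forall>j<5. \<forall>k<5. part (\<chi> j) k = part (\<chi> k) j"
      by (intro allI impI)
    have "peel (\<phi> j) (replicate (Suc i) j) = part (\<chi> j) j" for j
    proof -
      have "replicate (Suc i) j = replicate i j @ [j]"
        by (simp add: replicate_append_same)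
      then show ?thesis
        by (simp only: peel_append peel.simps \<chi>_def)
    qed
    then have "contract (\<lambda>j. part (\<chi> j) j)"
      using step(3) by (simp only:)
    with sym have "contract \<chi>"
      by (intro contract_Ker[THEN iffD2, OF \<chi>] conjI)
    then show ?case
      by (simp add: \<chi>_def[abs_def])
  qed
  from this[of 0] have "contract \<phi>"
    by simp
  have "glue \<phi> \<in> Ker (deg (Suc (Suc s)))"
  proof (rule Ker_deg_Suc[THEN iffD2])
    show "glue \<phi> \<in> P5 (deg (Suc (Suc s)))"
      unfolding deg_Suc[of "Suc s"] using \<phi> by (intro glue_P5) (auto intro: Ker_P5)
    show "(\<forall>j<5. part (glue \<phi>) j \<in> Ker (deg (Suc s))) \<and> contract (part (glue \<phi>))"
      using \<phi> \<open>contract \<phi>\<close> contract_cong[of "part (glue \<phi>)" \<phi>] by (simp add: part_glue)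
  qed (simp_all add: odd4_glue)
  moreover have "peel (glue \<phi>) w = f w" if "w \<in> wds (Suc s)" for w
    using that by (auto elim!: wds_SucE simp: part_glue peel)
  ultimately show ?case
    by blast
qed

section \<open>Families indexed by sets of variables\<close>

definition subs :: "nat \<Rightarrow> nat set set" where
  "subs s = {S. S \<subseteq> {..<5} \<and> S \<noteq> {} \<and> card S \<le> s}"

text \<open>The default value 0 outside \<open>subs s\<close> makes a family unique once its values
  on admissible sets are given, so that families can be counted.\<close>

definition set_systems :: "nat \<Rightarrow> (nat set \<Rightarrow> poly) set" where
  "set_systems s = {\<Theta>. (\<forall>S. S \<notin> subs s \<longrightarrow> \<Theta> S = 0) \<and> (\<forall>S\<in>subs s. \<Theta> S \<in> Ker 4) \<and>
    (\<forall>S. S \<subseteq> {..<5} \<longrightarrow> card S < s \<longrightarrow> contract (\<lambda>j. \<Theta> (insert j S)))}"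

lemma set_wds:
  assumes "w \<in> wds s" "0 < s"
  shows "set w \<in> subs s"
  using assms card_length[of w] by (auto simp: wds_def subs_def)

lemma word_system_set_system:
  assumes \<Theta>: "\<Theta> \<in> set_systems s" and s: "0 < s"
  shows "word_system s (\<lambda>w. \<Theta> (set w))"
  unfolding word_system_def
proof (intro conjI ballI allI impI)
  show "\<Theta> (set w) \<in> Ker 4" if "w \<in> wds s" for w
    using \<Theta> set_wds[OF that s] by (simp add: set_systems_def)
  show "\<Theta> (set w) = \<Theta> (set w')" if "set w = set w'" for w w'
    using that by simp
  fix t assume t: "s = Suc t"
  show "contract (\<lambda>j. \<Theta> (set (j # u)))" if "u \<in> wds t" for u
    using \<Theta> that t card_length[of u] by (auto simp: set_systems_def wds_def)
  have "contract (\<lambda>j. \<Theta> (insert j {}))"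
    using \<Theta> s by (simp add: set_systems_def)
  then show "contract (\<lambda>j. \<Theta> (set (replicate s j)))"
    using s by simp
qed

text \<open>A kernel element corresponds to the family sending S to its iterated part along any word
  with letter set S. For s = 0 the only word is empty while \<open>subs 0\<close> has no member,
  hence the assumption.\<close>

lemma card_Ker_deg:
  assumes s: "0 < s"
  shows "card (Ker (deg (Suc s))) = card (set_systems s)"
proof -
  have "\<forall>S. \<exists>w. S \<in> subs s \<longrightarrow> w \<in> wds s \<and> set w = S"
    using ex_wd[of _ s] by (auto simp: subs_def)
  then obtain wd where wd: "\<And>S. S \<in> subs s \<Longrightarrow> wd S \<in> wds s" "\<And>S. S \<in> subs s \<Longrightarrow> set (wd S) = S"
    by metis
  define G where "G \<phi> S = (if S \<in> subs s then peel \<phi> (wd S) else 0)" for \<phi> S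
  have G: "G \<phi> (set w) = peel \<phi> w" if "\<phi> \<in> Ker (deg (Suc s))" "w \<in> wds s" for \<phi> w
    using peel_set_dep[OF that(1) wd(1) that(2)] wd(2) set_wds[OF that(2) s] by (simp add: G_def)
  have "bij_betw G (Ker (deg (Suc s))) (set_systems s)"
    unfolding bij_betw_def
  proof (intro conjI set_eqI iffI)
    show "inj_on G (Ker (deg (Suc s)))"
    proof (rule inj_onI)
      fix \<phi> \<psi> assume K: "\<phi> \<in> Ker (deg (Suc s))" "\<psi> \<in> Ker (deg (Suc s))" and eq: "G \<phi> = G \<psi>"
      show "\<phi> = \<psi>"
      proof (rule peel_inject[OF K])
        show "peel \<phi> w = peel \<psi> w" if "w \<in> wds s" for w
          using G[OF K(1) that] G[OF K(2) that] eq by simp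
      qed
    qed
  next
    fix \<Theta> assume "\<Theta> \<in> G ` Ker (deg (Suc s))"
    then obtain \<phi> where \<phi>: "\<phi> \<in> Ker (deg (Suc s))" and \<Theta>: "\<Theta> = G \<phi>"
      by blast
    have W: "word_system s (peel \<phi>)"
      by (rule word_system_peel[OF \<phi>])
    obtain t where t: "s = Suc t"
      using s by (cases s) auto
    have "contract (\<lambda>j. G \<phi> (insert j S))" if S: "S \<subseteq> {..<5}" "card S < s" for S
    proof (cases "S = {}")
      case True
      have "contract (\<lambda>j. peel \<phi> (replicate s j))"
        by (rule word_systemD(4)[OF W t])
      then show ?thesis
        unfolding True
      proof (rule contract_congI)
        show "G \<phi> (insert j {}) = peel \<phi> (replicate s j)" if "j < 5" for j
          using G[OF \<phi> wds_replicate[OF that]] s by simp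
      qed
    next
      case False
      then obtain u where u: "u \<in> wds t" "set u = S"
        using ex_wd[of S t] S t by auto
      then have "contract (\<lambda>j. peel \<phi> (j # u))"
        by (intro word_systemD(3)[OF W t])
      then show ?thesis
      proof (rule contract_congI)
        show "G \<phi> (insert j S) = peel \<phi> (j # u)" if "j < 5" for j
          using G[OF \<phi>, of "j # u"] u t that by simp
      qed
    qed
    moreover have "G \<phi> S \<in> Ker 4" if "S \<in> subs s" for S
      using word_systemD(1)[OF W wd(1)[OF that]] that by (simp add: G_def)
    ultimately show "\<Theta> \<in> set_systems s"
      unfolding \<Theta> set_systems_def by (simp add: G_def)
  next
    fix \<Theta> assume \<Theta>: "\<Theta> \<in> set_systems s"
    obtain \<phi> where \<phi>: "\<phi> \<in> Ker (deg (Suc s))" "\<forall>w\<in>wds s. peel \<phi> w = \<Theta> (set w)"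
      using word_system_realised[OF word_system_set_system[OF \<Theta> s]] by blast
    have "\<Theta> S = G \<phi> S" for S
      using \<phi>(2) wd[of S] \<Theta> by (cases "S \<in> subs s") (auto simp: G_def set_systems_def)
    then have "\<Theta> = G \<phi>"
      by (rule ext)
    then show "\<Theta> \<in> G ` Ker (deg (Suc s))"
      using \<phi>(1) by blast
  qed
  then show ?thesis
    by (rule bij_betw_same_card)
qed

section \<open>Gaussian elimination on sparse vectors\<close>

text \<open>A trie is a sparse vector over the field with two elements, the set of paths ending at a
  node marked \<^const>\<open>True\<close> being its support; paths play the role of the unknowns, ordered
  lexicographically.\<close>

datatype trie = Lf | Nd bool trie trie

fun ev :: "(bool list \<Rightarrow> bit) \<Rightarrow> trie \<Rightarrow> bit" where
  "ev f Lf = 0"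
| "ev f (Nd p a b) = (if p then f [] else 0) + (ev (\<lambda>x. f (False # x)) a + ev (\<lambda>x. f (True # x)) b)"

fun vars :: "trie \<Rightarrow> bool list set" where
  "vars Lf = {}"
| "vars (Nd p a b) = (if p then {[]} else {}) \<union> (Cons False ` vars a \<union> Cons True ` vars b)"

text \<open>Normal form: \<open>Lf\<close> is the only representation of the zero vector, which
  ensures that the leading path of any other trie lies in its support.\<close>

fun nf :: "trie \<Rightarrow> bool" where
  "nf Lf = True"
| "nf (Nd p a b) = (nf a \<and> nf b \<and> (p \<or> a \<noteq> Lf \<or> b \<noteq> Lf))"

fun node :: "bool \<Rightarrow> trie \<Rightarrow> trie \<Rightarrow> trie" where
  "node False Lf Lf = Lf"
| "node p a b = Nd p a b"

fun tadd :: "trie \<Rightarrow> trie \<Rightarrow> trie" where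
  "tadd Lf t = t"
| "tadd (Nd p a b) Lf = Nd p a b"
| "tadd (Nd p a b) (Nd q c d) = node (p \<noteq> q) (tadd a c) (tadd b d)"

fun single :: "bool list \<Rightarrow> trie" where
  "single [] = Nd True Lf Lf"
| "single (False # p) = Nd False (single p) Lf"
| "single (True # p) = Nd False Lf (single p)"

text \<open>The greatest path of the support: \<open>True\<close> is preferred to
  \<open>False\<close>, and a longer path to its prefix.\<close>

fun lead :: "trie \<Rightarrow> bool list" where
  "lead (Nd p a (Nd q c d)) = True # lead (Nd q c d)"
| "lead (Nd p (Nd q c d) Lf) = False # lead (Nd q c d)"
| "lead _ = []"

lemma ev_node: "ev f (node p a b) = ev f (Nd p a b)"
  by (cases "(p, a, b)" rule: node.cases) auto

lemma vars_node: "vars (node p a b) = vars (Nd p a b)"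
  by (cases "(p, a, b)" rule: node.cases) auto

lemma nf_node: "nf a \<Longrightarrow> nf b \<Longrightarrow> nf (node p a b)"
  by (cases "(p, a, b)" rule: node.cases) auto

lemma ev_add: "ev f (tadd s t) = ev f s + ev f t"
proof (induction s t arbitrary: f rule: tadd.induct)
  case (3 p a b q c d)
  show ?case
    unfolding tadd.simps ev_node ev.simps 3 by (cases p; cases q) (simp_all add: add_ac)
qed simp_all

lemma vars_add: "vars (tadd s t) \<subseteq> vars s \<union> vars t"
proof (induction s t rule: tadd.induct)
  case (3 p a b q c d)
  show ?case
  proof
    fix x assume "x \<in> vars (tadd (Nd p a b) (Nd q c d))"
    then consider "x = []" "p \<noteq> q" | y where "x = False # y" "y \<in> vars (tadd a c)"
      | y where "x = True # y" "y \<in> vars (tadd b d)"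
      unfolding tadd.simps vars_node vars.simps by (auto split: if_splits)
    then show "x \<in> vars (Nd p a b) \<union> vars (Nd q c d)"
      by cases (use 3 in auto)
  qed
qed simp_all

lemma nf_add: "nf s \<Longrightarrow> nf t \<Longrightarrow> nf (tadd s t)"
  by (induction s t rule: tadd.induct) (simp_all add: nf_node del: node.simps)

lemma ev_single: "ev f (single p) = f p"
  by (induction p arbitrary: f rule: single.induct) simp_all

lemma vars_single: "vars (single p) = {p}"
  by (induction p rule: single.induct) simp_all

lemma nf_single: "nf (single p) \<and> single p \<noteq> Lf"
  by (induction p rule: single.induct) simp_all

lemma ev_cong: "(\<And>x. x \<in> vars r \<Longrightarrow> f x = g x) \<Longrightarrow> ev f r = ev g r"
proof (induction r arbitrary: f g)
  case (Nd p a b)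
  have "ev (\<lambda>x. f (False # x)) a = ev (\<lambda>x. g (False # x)) a"
    by (rule Nd.IH(1)) (simp add: Nd.prems)
  moreover have "ev (\<lambda>x. f (True # x)) b = ev (\<lambda>x. g (True # x)) b"
    by (rule Nd.IH(2)) (simp add: Nd.prems)
  ultimately show ?case
    using Nd.prems[of "[]"] by simp
qed simp

lemma ev_update: "x \<in> vars r \<Longrightarrow> ev (f(x := c)) r = ev f r + (f x + c)"
proof (induction r arbitrary: f x)
  case (Nd p a b)
  show ?case
  proof (cases x)
    case Nil
    have "(\<lambda>y. (f(x := c)) (e # y)) = (\<lambda>y. f (e # y))" for e
      using Nil by auto
    moreover have p
      using Nd.prems Nil by (auto split: if_splits)
    ultimately show ?thesis
      using Nil by (simp add: add_ac)
  next
    case (Cons e y)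
    have upd: "(\<lambda>z. (f(x := c)) (e # z)) = (\<lambda>z. f (e # z))(y := c)"
      "(\<lambda>z. (f(x := c)) ((\<not> e) # z)) = (\<lambda>z. f ((\<not> e) # z))" "(f(x := c)) [] = f []"
      using Cons by auto
    show ?thesis
    proof (cases e)
      case True
      then have "y \<in> vars b"
        using Nd.prems Cons by (auto split: if_splits)
      then show ?thesis
        using Nd.IH(2)[of y "\<lambda>z. f (True # z)"] upd Cons True by (simp add: add_ac del: fun_upd_apply)
    next
      case False
      then have "y \<in> vars a"
        using Nd.prems Cons by (auto split: if_splits)
      then show ?thesis
        using Nd.IH(1)[of y "\<lambda>z. f (False # z)"] upd Cons False by (simp add: add_ac del: fun_upd_apply)
    qed
  qed
qed simp

lemma lead_vars: "nf r \<Longrightarrow> r \<noteq> Lf \<Longrightarrow> lead r \<in> vars r"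
  by (induction r rule: lead.induct) auto

lemma le_lead: "x \<in> vars r \<Longrightarrow> x \<le> lead r"
  by (induction r arbitrary: x rule: lead.induct) (auto simp: less_bool_def split: if_splits)

text \<open>Rows in echelon form, each stored under its leading path.\<close>

datatype tab = TLf | TNd "trie option" tab tab

fun get :: "tab \<Rightarrow> bool list \<Rightarrow> trie option" where
  "get TLf p = None"
| "get (TNd x a b) [] = x"
| "get (TNd x a b) (False # p) = get a p"
| "get (TNd x a b) (True # p) = get b p"

text \<open>Descends along the leading path of the row itself, without building that path as a
  list.\<close>

fun look :: "tab \<Rightarrow> trie \<Rightarrow> trie option" where
  "look TLf r = None"
| "look (TNd x a b) (Nd p c (Nd q u v)) = look b (Nd q u v)"
| "look (TNd x a b) (Nd p (Nd q u v) Lf) = look a (Nd q u v)"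
| "look (TNd x a b) _ = x"

fun store :: "tab \<Rightarrow> trie \<Rightarrow> trie \<Rightarrow> tab" where
  "store TLf (Nd p c (Nd q u v)) y = TNd None TLf (store TLf (Nd q u v) y)"
| "store TLf (Nd p (Nd q u v) Lf) y = TNd None (store TLf (Nd q u v) y) TLf"
| "store TLf _ y = TNd (Some y) TLf TLf"
| "store (TNd x a b) (Nd p c (Nd q u v)) y = TNd x a (store b (Nd q u v) y)"
| "store (TNd x a b) (Nd p (Nd q u v) Lf) y = TNd x (store a (Nd q u v) y) b"
| "store (TNd x a b) _ y = TNd (Some y) a b"

lemma look_eq_get: "look B r = get B (lead r)"
  by (induction B r rule: look.induct) auto

lemma get_TNd:
  "get (TNd x a b) p = (case p of [] \<Rightarrow> x | e # p' \<Rightarrow> get (if e then b else a) p')"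
  by (cases "(TNd x a b, p)" rule: get.cases) auto

lemma get_store: "get (store B r y) p = (if p = lead r then Some y else get B p)"
  by (induction B r y arbitrary: p rule: store.induct) (simp_all add: get_TNd split: list.split)

text \<open>The first argument bounds the number of reduction steps; running out of it is a failure.\<close>

fun reduce :: "nat \<Rightarrow> tab \<Rightarrow> trie \<Rightarrow> trie option"
  and reduce' :: "nat \<Rightarrow> tab \<Rightarrow> trie \<Rightarrow> trie option \<Rightarrow> trie option" where
  "reduce n B Lf = Some Lf"
| "reduce 0 B (Nd p a b) = None"
| "reduce (Suc n) B (Nd p a b) = reduce' n B (Nd p a b) (look B (Nd p a b))"
| "reduce' n B r None = Some r"
| "reduce' n B r (Some q) = reduce n B (tadd r q)"

fun ins' :: "nat \<Rightarrow> tab \<Rightarrow> trie option \<Rightarrow> (nat \<times> tab) option" where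
  "ins' k B None = None"
| "ins' k B (Some Lf) = Some (k, B)"
| "ins' k B (Some (Nd p a b)) = Some (Suc k, store B (Nd p a b) (Nd p a b))"

fun ins :: "nat \<Rightarrow> (nat \<times> tab) option \<Rightarrow> trie \<Rightarrow> (nat \<times> tab) option" where
  "ins n None r = None"
| "ins n (Some (k, B)) r = ins' k B (reduce n B r)"

definition echelon :: "bool list set \<Rightarrow> tab \<Rightarrow> bool" where
  "echelon V B \<longleftrightarrow> (\<forall>p r. get B p = Some r \<longrightarrow> nf r \<and> r \<noteq> Lf \<and> lead r = p \<and> vars r \<subseteq> V)"

definition solves :: "(bool list \<Rightarrow> bit) \<Rightarrow> tab \<Rightarrow> bool" where
  "solves f B \<longleftrightarrow> (\<forall>p r. get B p = Some r \<longrightarrow> ev f r = 0)"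

text \<open>The rows added during reduction evaluate to 0 on every solution of the table, so values
  there are unchanged; reduction stops only at zero or at a new leading path.\<close>

lemma reduce_correct:
  assumes "reduce n B r = Some r'" "echelon V B" "nf r" "vars r \<subseteq> V"
  shows "nf r' \<and> vars r' \<subseteq> V \<and> (r' \<noteq> Lf \<longrightarrow> get B (lead r') = None) \<and>
    (\<forall>f. solves f B \<longrightarrow> ev f r' = ev f r)"
  using assms
proof (induction n arbitrary: r)
  case 0
  then show ?case
    by (cases r) auto
next
  case (Suc n)
  show ?case
  proof (cases r)
    case Lf
    then show ?thesis
      using Suc.prems by auto
  next
    case (Nd p a b)
    show ?thesis
    proof (cases "look B r")
      case None
      then show ?thesis
        using Suc.prems Nd by (auto simp: look_eq_get)
    next
      case (Some q)
      then have "get B (lead r) = Some q"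
        by (simp add: look_eq_get)
      then have q: "nf q" "vars q \<subseteq> V" "\<And>f. solves f B \<Longrightarrow> ev f q = 0"
        using Suc.prems(2) unfolding echelon_def solves_def by blast+
      have red: "reduce n B (tadd r q) = Some r'"
        using Suc.prems(1) Some Nd by simp
      have "vars (tadd r q) \<subseteq> V"
        using vars_add[of r q] Suc.prems(4) q(2) by blast
      then have "nf r' \<and> vars r' \<subseteq> V \<and> (r' \<noteq> Lf \<longrightarrow> get B (lead r') = None) \<and>
        (\<forall>f. solves f B \<longrightarrow> ev f r' = ev f (tadd r q))"
        by (rule Suc.IH[OF red Suc.prems(2) nf_add[OF Suc.prems(3) q(1)]])
      then show ?thesis
        using q(3) by (simp add: ev_add)
    qed
  qed
qed

text \<open>The invariant of the elimination, in which \<open>k\<close> is the rank of the equations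
  \<open>R\<close>.\<close>

definition reaches :: "bool list set \<Rightarrow> trie set \<Rightarrow> nat \<Rightarrow> tab \<Rightarrow> bool" where
  "reaches V R k B \<longleftrightarrow> echelon V B \<and> (\<forall>f. solves f B \<longleftrightarrow> (\<forall>r\<in>R. ev f r = 0)) \<and>
    finite (dom (get B)) \<and> card (dom (get B)) = k"

lemma reaches_empty: "reaches V {} 0 TLf"
  by (simp add: reaches_def echelon_def solves_def dom_def)

lemma reaches_ins:
  assumes B: "reaches V R k B" and r: "nf r" "vars r \<subseteq> V"
    and i: "ins n (Some (k, B)) r = Some (k', B')"
  shows "reaches V (insert r R) k' B'"
proof -
  have e: "echelon V B"
    using B by (simp add: reaches_def)
  obtain r' where r': "reduce n B r = Some r'"
    using i by (cases "reduce n B r") auto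
  note c = reduce_correct[OF r' e r]
  show ?thesis
  proof (cases r')
    case Lf
    then have kB: "k' = k" "B' = B"
      using i r' by auto
    have "ev f r = 0" if "solves f B" for f
      using c that Lf by auto
    then show ?thesis
      using B unfolding kB reaches_def by auto
  next
    case (Nd p a b)
    then have kB: "k' = Suc k" "B' = store B r' r'"
      using i r' by auto
    have g: "get B' x = (if x = lead r' then Some r' else get B x)" for x
      unfolding kB(2) by (rule get_store)
    have new: "get B (lead r') = None"
      using c Nd by blast
    have s: "solves f B' \<longleftrightarrow> solves f B \<and> ev f r' = 0" for f
    proof
      assume l: "solves f B'"
      have "ev f q = 0" if "get B x = Some q" for x q
        using l that g[of x] new unfolding solves_def by (cases "x = lead r'") auto
      moreover have "ev f r' = 0"
        using l g[of "lead r'"] unfolding solves_def by auto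
      ultimately show "solves f B \<and> ev f r' = 0"
        unfolding solves_def by blast
    next
      assume "solves f B \<and> ev f r' = 0"
      then show "solves f B'"
        unfolding solves_def g by auto
    qed
    have "solves f B' \<longleftrightarrow> (\<forall>q\<in>insert r R. ev f q = 0)" for f
    proof -
      have "solves f B \<Longrightarrow> ev f r' = ev f r"
        using c by blast
      then show ?thesis
        using B unfolding s reaches_def by auto
    qed
    moreover have "echelon V B'"
      using e c Nd unfolding echelon_def g by auto
    moreover have "dom (get B') = insert (lead r') (dom (get B))"
      using g by (auto simp: dom_def split: if_splits)
    moreover have "lead r' \<notin> dom (get B)"
      using new by auto
    ultimately show ?thesis
      using B unfolding reaches_def kB(1) by simp
  qed
qed

lemma ins_None: "foldl (ins n) None rs = None"
  by (induction rs) auto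

lemma reaches_foldl:
  assumes "reaches V R k B" "\<And>r. r \<in> set rs \<Longrightarrow> nf r \<and> vars r \<subseteq> V"
    and "foldl (ins n) (Some (k, B)) rs = Some (k', B')"
  shows "reaches V (R \<union> set rs) k' B'"
  using assms
proof (induction rs arbitrary: R k B)
  case (Cons r rs)
  then obtain k1 B1 where 1: "ins n (Some (k, B)) r = Some (k1, B1)"
    using ins_None[of n rs] by (cases "ins n (Some (k, B)) r") auto
  have "reaches V (insert r R) k1 B1"
    by (rule reaches_ins[OF Cons.prems(1) _ _ 1]) (use Cons.prems(2) in auto)
  then have "reaches V (insert r R \<union> set rs) k' B'"
    by (rule Cons.IH) (use Cons.prems(2,3) 1 in auto)
  then show ?case
    by simp
qed simp

text \<open>Consider the greatest unknown m. If it is a pivot, its own equation determines its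
  value; otherwise it is free and doubles the number of solutions. Equations with smaller pivots do
  not see it.\<close>

lemma card_triangular:
  fixes V :: "'v::linorder set" and e :: "'v \<Rightarrow> ('v \<Rightarrow> bit) \<Rightarrow> bit"
  assumes "finite V" "P \<subseteq> V"
    and dep: "\<And>p f g. p \<in> P \<Longrightarrow> (\<And>x. x \<le> p \<Longrightarrow> f x = g x) \<Longrightarrow> e p f = e p g"
    and upd: "\<And>p f c. p \<in> P \<Longrightarrow> e p (f(p := c)) = e p f + (f p + c)"
  shows "card {f \<in> supp_in V. \<forall>p\<in>P. e p f = 0} * 2 ^ card P = 2 ^ card V"
  using assms
proof (induction V arbitrary: P rule: finite_linorder_max_induct)
  case empty
  have P: "P = {}"
    using empty(1) by simp
  have "{f \<in> supp_in {}. \<forall>p\<in>P. e p f = 0} = {\<lambda>x. 0 :: bit}"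
    unfolding P by (auto simp: supp_in_def fun_eq_iff)
  then show ?case
    by (simp add: P)
next
  case (insert m V)
  define Q where "Q = P - {m}"
  let ?sol = "\<lambda>V P. {f \<in> supp_in V. \<forall>p\<in>P. e p f = 0}"
  have Q: "Q \<subseteq> V"
    using insert.prems(1) by (auto simp: Q_def)
  have m: "m \<notin> V"
    using insert.hyps(2) by blast
  have fin: "finite (?sol V Q)"
    by (rule finite_subset[OF _ finite_supp_in[OF insert.hyps(1)]]) blast
  have IH: "card (?sol V Q) * 2 ^ card Q = 2 ^ card V"
  proof (rule insert.IH[OF Q])
    fix p assume "p \<in> Q"
    then have p: "p \<in> P"
      by (simp add: Q_def)
    show "e p f = e p g" if "\<And>x. x \<le> p \<Longrightarrow> f x = g x" for f g
      by (rule insert.prems(2)[OF p that])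
    show "e p (f(p := c)) = e p f + (f p + c)" for f c
      by (rule insert.prems(3)[OF p])
  qed
  have Qm: "e p (f(m := c)) = e p f" if "p \<in> Q" for p f c
  proof (rule insert.prems(2))
    show "p \<in> P"
      using that by (simp add: Q_def)
    show "(f(m := c)) x = f x" if "x \<le> p" for x
    proof -
      have "p < m"
        using insert.hyps(2) Q \<open>p \<in> Q\<close> by auto
      then have "x \<noteq> m"
        using that by auto
      then show ?thesis by simp
    qed
  qed
  have supp: "f(m := 0) \<in> supp_in V" if "f \<in> supp_in (insert m V)" for f
    using that by (auto simp: supp_in_def)
  have supp': "g(m := c) \<in> supp_in (insert m V)" if "g \<in> supp_in V" for g c
    using that by (auto simp: supp_in_def)
  have zero: "g m = 0" if "g \<in> supp_in V" for g
    using that m by (auto simp: supp_in_def)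
  have inj: "inj_on (\<lambda>g. g(m := c g)) (?sol V Q)" for c
  proof (rule inj_onI)
    fix g h assume gh: "g \<in> ?sol V Q" "h \<in> ?sol V Q" and eq: "g(m := c g) = h(m := c h)"
    show "g = h"
    proof
      show "g x = h x" for x
        using fun_cong[OF eq, of x] zero[of g] zero[of h] gh by (cases "x = m") auto
    qed
  qed
  show ?case
  proof (cases "m \<in> P")
    case True
    have P: "P = insert m Q"
      using True by (auto simp: Q_def)
    have "?sol (insert m V) P = (\<lambda>g. g(m := e m g)) ` ?sol V Q"
    proof (intro equalityI subsetI)
      fix f assume f: "f \<in> ?sol (insert m V) P"
      let ?g = "f(m := 0)"
      have "e m ?g = f m"
      proof -
        have "e m f = 0"
          using f P by simp
        then show ?thesis
          unfolding insert.prems(3)[OF True] by simp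
      qed
      then have "f = ?g(m := e m ?g)"
        by (auto simp: fun_eq_iff)
      moreover have "?g \<in> ?sol V Q"
        using f supp P by (auto simp: Qm)
      ultimately show "f \<in> (\<lambda>g. g(m := e m g)) ` ?sol V Q"
        by blast
    next
      fix f assume "f \<in> (\<lambda>g. g(m := e m g)) ` ?sol V Q"
      then obtain g where g: "g \<in> ?sol V Q" and f: "f = g(m := e m g)"
        by blast
      have "e m f = 0"
      proof -
        have "g m = 0"
          using g by (intro zero) simp
        then show ?thesis
          unfolding f insert.prems(3)[OF True] by simp
      qed
      then show "f \<in> ?sol (insert m V) P"
        using g supp' unfolding P by (auto simp: f Qm)
    qed
    then have "card (?sol (insert m V) P) = card (?sol V Q)"
      by (simp only: card_image[OF inj])
    moreover have "card P = Suc (card Q)"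
      unfolding P using finite_subset[OF Q insert.hyps(1)] m Q by (subst card_insert_disjoint) auto
    ultimately show ?thesis
      using IH m insert.hyps(1) by simp
  next
    case False
    then have P: "P = Q"
      by (auto simp: Q_def)
    have sol: "?sol (insert m V) Q = ?sol V Q \<union> (\<lambda>g. g(m := 1)) ` ?sol V Q"
    proof (intro equalityI subsetI)
      fix f assume f: "f \<in> ?sol (insert m V) Q"
      let ?g = "f(m := 0)"
      have g: "?g \<in> ?sol V Q"
        using f supp by (auto simp: Qm)
      show "f \<in> ?sol V Q \<union> (\<lambda>g. g(m := 1)) ` ?sol V Q"
      proof (cases "f m = 0")
        case True
        then have "f = ?g"
          by (auto simp: fun_eq_iff)
        then show ?thesis
          using g by simp
      next
        case False
        then have "f = ?g(m := 1)"
          by (auto simp: fun_eq_iff)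
        then show ?thesis
          using g by blast
      qed
    next
      fix f assume "f \<in> ?sol V Q \<union> (\<lambda>g. g(m := 1)) ` ?sol V Q"
      then show "f \<in> ?sol (insert m V) Q"
      proof
        assume "f \<in> ?sol V Q"
        then show ?thesis
          by (auto simp: supp_in_def)
      next
        assume "f \<in> (\<lambda>g. g(m := 1)) ` ?sol V Q"
        then show ?thesis
          using supp' by (auto simp: Qm)
      qed
    qed
    have "?sol V Q \<inter> (\<lambda>g. g(m := 1)) ` ?sol V Q = {}"
      using zero by force
    then have "card (?sol (insert m V) Q) = card (?sol V Q) + card (?sol V Q)"
      unfolding sol using fin by (simp only: card_Un_disjoint finite_imageI card_image[OF inj])
    then show ?thesis
      using IH m insert.hyps(1) unfolding P by (simp add: algebra_simps)
  qed
qed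

lemma card_reaches:
  assumes B: "reaches V R k B" and V: "finite V"
  shows "card {f \<in> supp_in V. \<forall>r\<in>R. ev f r = 0} * 2 ^ k = 2 ^ card V"
proof -
  let ?P = "dom (get B)"
  define e where "e p f = ev f (the (get B p))" for p f
  have r: "nf (the (get B p)) \<and> the (get B p) \<noteq> Lf \<and> lead (the (get B p)) = p \<and>
    vars (the (get B p)) \<subseteq> V" if "p \<in> ?P" for p
  proof -
    from that obtain y where "get B p = Some y"
      by auto
    moreover have "echelon V B"
      using B by (simp add: reaches_def)
    ultimately show ?thesis
      unfolding echelon_def by simp
  qed
  have "card {f \<in> supp_in V. \<forall>p\<in>?P. e p f = 0} * 2 ^ card ?P = 2 ^ card V"
  proof (rule card_triangular[OF V])
    show "?P \<subseteq> V"
      using r lead_vars by (metis subset_iff)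
    show "e p f = e p g" if p: "p \<in> ?P" and fg: "\<And>x. x \<le> p \<Longrightarrow> f x = g x" for p f g
      unfolding e_def using r[OF p] le_lead by (intro ev_cong fg) metis
    show "e p (f(p := c)) = e p f + (f p + c)" if p: "p \<in> ?P" for p f c
      unfolding e_def using r[OF p] lead_vars by (intro ev_update) metis
  qed
  moreover have "(\<forall>p\<in>?P. e p f = 0) \<longleftrightarrow> (\<forall>r\<in>R. ev f r = 0)" for f
  proof -
    have "(\<forall>p\<in>?P. e p f = 0) \<longleftrightarrow> solves f B"
      unfolding e_def solves_def dom_def by auto
    then show ?thesis
      using B unfolding reaches_def by blast
  qed
  ultimately show ?thesis
    using B unfolding reaches_def by simp
qed

section \<open>The linear system in degree four\<close>

text \<open>The last exponent is left out, as it is determined by the degree.\<close>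

fun code :: "nat list \<Rightarrow> bool list" where
  "code [] = []"
| "code [x] = []"
| "code (Suc k # x # xs) = False # code (k # x # xs)"
| "code (0 # x # xs) = True # code (x # xs)"

fun oddn :: "nat \<Rightarrow> bool" where
  "oddn 0 = False"
| "oddn (Suc 0) = True"
| "oddn (Suc (Suc n)) = oddn n"

fun comps :: "nat \<Rightarrow> nat \<Rightarrow> nat list list" where
  "comps 0 s = [[s]]"
| "comps (Suc k) 0 = map (Cons 0) (comps k 0)"
| "comps (Suc k) (Suc s) = map (Cons 0) (comps k (Suc s)) @ map (\<lambda>l. Suc (hd l) # tl l) (comps (Suc k) s)"

text \<open>An entry \<open>False\<close> marks a variable that belongs to the set, so these lists
  are the sets of size \<open>k\<close>.\<close>

fun bls :: "nat \<Rightarrow> nat \<Rightarrow> bool list list" where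
  "bls 0 0 = [[]]"
| "bls 0 (Suc k) = []"
| "bls (Suc n) 0 = map (Cons True) (bls n 0)"
| "bls (Suc n) (Suc k) = map (Cons True) (bls n (Suc k)) @ map (Cons False) (bls n k)"

definition idx :: "nat list" where
  "idx = [0, Suc 0, Suc (Suc 0), Suc (Suc (Suc 0)), Suc (Suc (Suc (Suc 0)))]"

text \<open>The equation \<phi>(Sq^1 x^a) = 0 for the functional at the set
  \<open>S\<close>.\<close>

definition ker_row :: "bool list \<Rightarrow> nat list \<Rightarrow> trie" where
  "ker_row S a = foldr (\<lambda>i r. if oddn (a ! i)
    then tadd (single (code (a[i := Suc (a ! i)]) @ S)) r else r) idx Lf"

text \<open>The contraction at the set \<open>S\<close>, evaluated at x^a. The test
  \<open>True\<close> gives it the shape of \<open>ker_row\<close>, so that the same facts about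
  \<open>foldr\<close> serve both.\<close>

definition contract_row :: "bool list \<Rightarrow> nat list \<Rightarrow> trie" where
  "contract_row S a = foldr (\<lambda>i r. if True
    then tadd (single (code (a[i := Suc (a ! i)]) @ S[i := False])) r else r) idx Lf"

definition mons3 :: "nat list list" where
  "mons3 = comps 4 3"

definition stage :: "nat \<Rightarrow> trie list" where
  "stage t = concat (map (\<lambda>S. map (ker_row S) mons3) (bls 5 (Suc t))) @
    concat (map (\<lambda>S. map (contract_row S) mons3) (bls 5 t))"

fun counts :: "nat \<Rightarrow> (nat \<times> tab) option \<Rightarrow> trie list list \<Rightarrow> nat option list"
  and counts' :: "nat \<Rightarrow> (nat \<times> tab) option \<Rightarrow> trie list list \<Rightarrow> nat option list" where
  "counts n st [] = []"
| "counts n st (rs # rss) = counts' n (foldl (ins n) st rs) rss"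
| "counts' n st rss = map_option fst st # counts n st rss"

lemma counts_nth:
  "t < length rss \<Longrightarrow> counts n st rss ! t =
    map_option fst (foldl (ins n) st (concat (take (Suc t) rss)))"
proof (induction rss arbitrary: st t)
  case (Cons rs rss)
  then show ?case
    by (cases t) simp_all
qed simp

definition mon_list :: "mon \<Rightarrow> nat list" where
  "mon_list a = map a [0..<5]"

definition set_bits :: "nat set \<Rightarrow> bool list" where
  "set_bits S = map (\<lambda>i. i \<notin> S) [0..<5]"

text \<open>The order of the unknowns that this encoding induces keeps the elimination sparse.\<close>

definition var_path :: "nat set \<Rightarrow> mon \<Rightarrow> bool list" where
  "var_path S m = code (mon_list m) @ set_bits S"

section \<open>Faithfulness of the encoding\<close>

lemma oddn_iff: "oddn n \<longleftrightarrow> odd n"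
  by (induction n rule: oddn.induct) simp_all

lemma length_mon_list: "length (mon_list a) = 5" and length_set_bits: "length (set_bits S) = 5"
  by (simp_all add: mon_list_def set_bits_def)

lemma nth_mon_list: "i < 5 \<Longrightarrow> mon_list a ! i = a i"
  by (simp add: mon_list_def)

lemma mon_list_update: "i < 5 \<Longrightarrow> (mon_list a)[i := Suc (a i)] = mon_list (a + ind {i})"
  by (rule nth_equalityI) (auto simp: length_mon_list nth_mon_list nth_list_update ind_def)

lemma set_bits_update: "i < 5 \<Longrightarrow> (set_bits S)[i := False] = set_bits (insert i S)"
  by (rule nth_equalityI) (auto simp: set_bits_def nth_list_update)

lemma sum_list_mon_list: "sum_list (mon_list a) = (\<Sum>i<5. a i)"
  by (simp add: mon_list_def interv_sum_list_conv_sum_set_nat atLeast0LessThan)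

lemma sum_list_idx: "(\<Sum>i\<leftarrow>idx. h i) = (\<Sum>i<5. h i :: bit)"
  by (simp add: idx_def eval_nat_numeral add_ac)

lemma set_idx: "set idx = {..<5}"
  by (auto simp: idx_def eval_nat_numeral)

text \<open>Every exponent but the last is written in unary with an end mark, so codes of lists of
  equal length are prefix free. The last exponent leaves no trace, hence
  \<open>butlast\<close>.\<close>

lemma code_inject:
  "length xs = length ys \<Longrightarrow> code xs @ t = code ys @ t' \<Longrightarrow> butlast xs = butlast ys \<and> t = t'"
proof (induction xs arbitrary: ys rule: code.induct)
  case 1
  then show ?case
    by simp
next
  case (2 x)
  then show ?case
    by (cases ys) auto
next
  case (3 k x xs)
  then obtain y z zs where ys: "ys = y # z # zs"
    by (cases ys; cases "tl ys") auto
  show ?case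
  proof (cases y)
    case 0
    then show ?thesis
      using 3(3) ys by simp
  next
    case (Suc l)
    then have "butlast (k # x # xs) = butlast (l # z # zs) \<and> t = t'"
      using 3 ys by (intro 3(1)) simp_all
    then show ?thesis
      using ys Suc by simp
  qed
next
  case (4 x xs)
  then obtain y z zs where ys: "ys = y # z # zs"
    by (cases ys; cases "tl ys") auto
  show ?case
  proof (cases y)
    case 0
    then have "butlast (x # xs) = butlast (z # zs) \<and> t = t'"
      using 4 ys by (intro 4(1)) simp_all
    then show ?thesis
      using ys 0 by simp
  next
    case (Suc l)
    then show ?thesis
      using 4(3) ys by simp
  qed
qed

text \<open>The last exponent, absent from the path, is recovered from the common degree.\<close>

lemma var_path_inject:
  assumes "m \<in> mons5 n" "m' \<in> mons5 n" "S \<subseteq> {..<5}" "S' \<subseteq> {..<5}" "var_path S m = var_path S' m'"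
  shows "S = S' \<and> m = m'"
proof -
  have b: "butlast (mon_list m) = butlast (mon_list m')" and S: "set_bits S = set_bits S'"
    using code_inject[of "mon_list m" "mon_list m'" "set_bits S" "set_bits S'"] assms(5) by (simp_all add: length_mon_list var_path_def)
  have ap: "mon_list a = butlast (mon_list a) @ [last (mon_list a)]" for a
    using length_mon_list[of a] by (intro append_butlast_last_id[symmetric]) auto
  have "sum_list (mon_list m) = sum_list (mon_list m')"
    using assms(1,2) by (simp add: sum_list_mon_list mons5_def)
  then have "last (mon_list m) = last (mon_list m')"
    using b by (subst (asm) (1 2) ap) simp
  then have mon_list: "mon_list m = mon_list m'"
    using b by (subst (1 2) ap) simp
  have "m i = m' i" for i
  proof (cases "i < 5")
    case True
    then show ?thesis
      using nth_mon_list[of i m] nth_mon_list[of i m'] mon_list by simp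
  next
    case False
    then show ?thesis
      using assms(1,2) by (simp add: mons5_def)
  qed
  moreover have "i \<in> S \<longleftrightarrow> i \<in> S'" for i
  proof (cases "i < 5")
    case True
    then have "set_bits S ! i \<longleftrightarrow> i \<notin> S" "set_bits S' ! i \<longleftrightarrow> i \<notin> S'"
      by (simp_all add: set_bits_def)
    then show ?thesis
      using S by simp
  qed (use assms(3,4) in auto)
  ultimately show ?thesis
    by auto
qed

lemma ev_foldr:
  "ev f (foldr (\<lambda>i r. if P i then tadd (g i) r else r) xs Lf) =
    (\<Sum>i\<leftarrow>xs. if P i then ev f (g i) else 0)"
  by (induction xs) (simp_all add: ev_add)

lemma nf_foldr: "(\<And>i. nf (g i)) \<Longrightarrow> nf (foldr (\<lambda>i r. if P i then tadd (g i) r else r) xs Lf)"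
  by (induction xs) (simp_all add: nf_add)

lemma vars_foldr:
  "vars (foldr (\<lambda>i r. if P i then tadd (g i) r else r) xs Lf) \<subseteq> (\<Union>i\<in>{i \<in> set xs. P i}. vars (g i))"
proof (induction xs)
  case (Cons x xs)
  show ?case
    using Cons.IH vars_add[of "g x" "foldr (\<lambda>i r. if P i then tadd (g i) r else r) xs Lf"]
    by (cases "P x") auto
qed simp

lemma ev_ker_row:
  "ev f (ker_row (set_bits S) (mon_list a)) = (\<Sum>i<5. if odd (a i) then f (var_path S (a + ind {i})) else 0)"
  unfolding ker_row_def ev_foldr sum_list_idx ev_single
  by (rule sum.cong) (auto simp: nth_mon_list mon_list_update var_path_def oddn_iff)

lemma ev_contract_row: "ev f (contract_row (set_bits S) (mon_list a)) = (\<Sum>i<5. f (var_path (insert i S) (a + ind {i})))"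
  unfolding contract_row_def ev_foldr sum_list_idx ev_single
  by (rule sum.cong) (auto simp: nth_mon_list mon_list_update set_bits_update var_path_def)

lemma vars_ker_row: "vars (ker_row (set_bits S) (mon_list a)) \<subseteq> (\<lambda>i. var_path S (a + ind {i})) ` {..<5}"
  unfolding ker_row_def
  by (rule order_trans[OF vars_foldr]) (auto simp: vars_single set_idx nth_mon_list mon_list_update var_path_def)

lemma vars_contract_row: "vars (contract_row (set_bits S) (mon_list a)) \<subseteq> (\<lambda>i. var_path (insert i S) (a + ind {i})) ` {..<5}"
  unfolding contract_row_def
  by (rule order_trans[OF vars_foldr])
    (auto simp: vars_single set_idx nth_mon_list mon_list_update set_bits_update var_path_def)

lemma nf_ker_row: "nf (ker_row S a)" and nf_contract_row: "nf (contract_row S a)"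
  unfolding ker_row_def contract_row_def by (rule nf_foldr, simp add: nf_single)+

lemma ind_mons5: "i < 5 \<Longrightarrow> ind {i} \<in> mons5 1"
  by (simp add: mons5_def ind_def)

lemma mons5_add_ind: "a \<in> mons5 n \<Longrightarrow> i < 5 \<Longrightarrow> a + ind {i} \<in> mons5 (Suc n)"
  using mons5_add[OF _ ind_mons5] by fastforce

lemma mons5_1: "mons5 1 = (\<lambda>i. ind {i}) ` {..<5}"
proof (intro equalityI subsetI)
  fix a assume a: "a \<in> mons5 1"
  then have "(\<Sum>i<5. a i) = 1"
    by (simp add: mons5_def)
  then obtain i where i: "i < 5" "a i = 1" "\<forall>j<5. i \<noteq> j \<longrightarrow> a j = 0"
    using sum_eq_1_iff[of "{..<5}" a] by auto
  have "a = ind {i}"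
  proof
    show "a k = ind {i} k" for k
      using i a by (cases "k < 5") (auto simp: ind_def mons5_def)
  qed
  then show "a \<in> (\<lambda>i. ind {i}) ` {..<5}"
    using i by auto
qed (auto simp: mons5_def ind_def)

lemma DSq_1: "DSq 1 \<phi> a = (\<Sum>i<5. if odd (a i) then \<phi> (a + ind {i}) else 0)"
proof -
  have inj: "inj_on (\<lambda>i. ind {i}) {..<5}"
  proof (rule inj_onI)
    fix i j assume eq: "ind {i} = ind {j}"
    have "ind {i} i = ind {j} i"
      by (simp only: eq)
    then show "i = j"
      by (simp add: ind_def split: if_splits)
  qed
  have "DSq 1 \<phi> a = (\<Sum>i<5. of_nat (\<Prod>j<5. a j choose ind {i} j) * \<phi> (a + ind {i}))"
    unfolding DSq_def mons5_1 using inj by (simp add: sum.reindex)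
  also have "\<dots> = (\<Sum>i<5. if odd (a i) then \<phi> (a + ind {i}) else 0)"
  proof (rule sum.cong)
    fix i :: nat assume "i \<in> {..<5}"
    have "(\<Prod>j<5. a j choose ind {i} j) = (\<Prod>j<5. if j = i then a i else 1)"
      by (rule prod.cong) (auto simp: ind_def)
    then have "(\<Prod>j<5. a j choose ind {i} j) = a i"
      using \<open>i \<in> {..<5}\<close> by simp
    moreover have "of_nat (a i) = (if odd (a i) then 1 else 0 :: bit)"
      by (cases "even (a i)") (auto elim!: evenE oddE)
    ultimately show "of_nat (\<Prod>j<5. a j choose ind {i} j) * \<phi> (a + ind {i}) =
      (if odd (a i) then \<phi> (a + ind {i}) else 0)"
      by simp
  qed simp
  finally show ?thesis .
qed

text \<open>For \<open>|a| = 2\<close> and \<open>a\<^sub>j > 0\<close>, the condition \<open>Sq\<^sup>2 x\<^sup>a = x\<^sup>2\<^sup>a\<close> coincides with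
  \<open>Sq\<^sup>1 (x\<^sup>2\<^sup>a / x\<^sub>j) = x\<^sup>2\<^sup>a\<close>, so that \<open>Sq\<^sup>1\<close> alone cuts out the kernel in degree \<open>4\<close>.\<close>

lemma Ker_4:
  assumes P: "\<phi> \<in> P5 4"
  shows "\<phi> \<in> Ker 4 \<longleftrightarrow>
    (\<forall>a\<in>mons5 3. (\<Sum>i<5. if odd (a i) then \<phi> (a + ind {i}) else 0) = 0)"
proof
  assume "\<phi> \<in> Ker 4"
  then show "\<forall>a\<in>mons5 3. (\<Sum>i<5. if odd (a i) then \<phi> (a + ind {i}) else 0) = 0"
    unfolding DSq_1[symmetric] by (simp add: Ker_def mons5_def)
next
  assume r: "\<forall>a\<in>mons5 3. (\<Sum>i<5. if odd (a i) then \<phi> (a + ind {i}) else 0) = 0"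
  have "DSq k \<phi> a = 0" if k: "0 < k" and a: "\<forall>i\<ge>5. a i = 0" for k a
  proof (cases "(\<Sum>i<5. a i) + k = 4")
    case False
    then show ?thesis
      by (rule DSq_outside[OF P])
  next
    case True
    \<comment> \<open>In the third case Sq^k exceeds the degree of x^a and therefore vanishes on
      it.\<close>
    consider "k = 1" | "k = 2" | "(\<Sum>i<5. a i) < k"
      using True k by linarith
    then show ?thesis
    proof cases
      case 1
      then have "a \<in> mons5 3"
        using True a by (simp add: mons5_def)
      then show ?thesis
        unfolding 1 DSq_1 using r by blast
    next
      case 2
      then have s: "(\<Sum>i<5. a i) = 2"
        using True by simp
      then obtain j where j: "j < 5" "a j \<noteq> 0"
        by (metis lessThan_iff sum.neutral zero_neq_numeral)
      define b where "b = (\<lambda>i. 2 * a i - ind {j} i)"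
      have b: "b + ind {j} = a + a"
        using j by (auto simp: b_def ind_def fun_eq_iff)
      have "(\<Sum>i<5. (b + ind {j}) i) = 4"
        unfolding b by (simp add: sum.distrib s)
      moreover have "(\<Sum>i<5. ind {j} i) = 1"
        using ind_mons5[OF j(1)] by (simp add: mons5_def)
      ultimately have "b \<in> mons5 3"
        using a by (simp add: mons5_def sum.distrib) (simp add: b_def)
      then have "0 = (\<Sum>i<5. if odd (b i) then \<phi> (b + ind {i}) else 0)"
        using r by simp
      also have "\<dots> = (\<Sum>i<5. if i = j then \<phi> (b + ind {i}) else 0)"
        using j by (intro sum.cong) (auto simp: b_def ind_def)
      also have "\<dots> = \<phi> (a + a)"
        using j by (simp add: b)
      also have "\<dots> = DSq k \<phi> a"
        unfolding 2 s[symmetric] DSq_eq_mSq mSq_top[OF a] by simp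
      finally show ?thesis
        by simp
    next
      case 3
      have z: "(\<Prod>i<5. a i choose c i) = 0" if "c \<in> mons5 k" for c
      proof -
        have "\<exists>i<5. a i < c i"
        proof (rule ccontr)
          assume n: "\<not> ?thesis"
          have "c i \<le> a i" if "i \<in> {..<5}" for i
            using n that by force
          then have "(\<Sum>i<5. c i) \<le> (\<Sum>i<5. a i)"
            by (rule sum_mono)
          then show False
            using 3 that by (simp add: mons5_def)
        qed
        then show ?thesis
          by (auto simp: prod_zero_iff intro: binomial_eq_0)
      qed
      then show ?thesis
        unfolding DSq_def by (intro sum.neutral ballI) (simp only: z of_nat_0 mult_zero_left)
    qed
  qed
  then show "\<phi> \<in> Ker 4"
    using P by (simp add: Ker_def)
qed

lemma set_comps: "set (comps k s) = {l. length l = Suc k \<and> sum_list l = s}"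
proof (induction k s rule: comps.induct)
  case (1 s)
  show ?case
    by (auto simp: length_Suc_conv)
next
  case (2 k)
  show ?case
    unfolding comps.simps set_map 2 by (auto simp: length_Suc_conv)
next
  case (3 k s)
  show ?case
  proof (intro equalityI subsetI)
    fix l assume "l \<in> set (comps (Suc k) (Suc s))"
    then show "l \<in> {l. length l = Suc (Suc k) \<and> sum_list l = Suc s}"
      unfolding comps.simps set_append set_map 3 by (auto simp: length_Suc_conv)
  next
    fix l assume "l \<in> {l. length l = Suc (Suc k) \<and> sum_list l = Suc s}"
    then obtain x xs where l: "l = x # xs" "length xs = Suc k" "x + sum_list xs = Suc s"
      by (auto simp: length_Suc_conv)
    show "l \<in> set (comps (Suc k) (Suc s))"
    proof (cases x)
      case 0
      then show ?thesis
        unfolding comps.simps set_append set_map 3 using l by simp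
    next
      case (Suc y)
      then have "y # xs \<in> {l. length l = Suc (Suc k) \<and> sum_list l = s}"
        using l by simp
      then have "l \<in> (\<lambda>l. Suc (hd l) # tl l) ` {l. length l = Suc (Suc k) \<and> sum_list l = s}"
        using l(1) Suc by (intro image_eqI[of _ _ "y # xs"]) simp_all
      then show ?thesis
        unfolding comps.simps set_append set_map 3 by blast
    qed
  qed
qed

lemma set_bls: "set (bls n k) = {l. length l = n \<and> count_list l False = k}"
proof (induction n k rule: bls.induct)
  case (3 n)
  show ?case
    unfolding bls.simps set_map 3 by (auto simp: length_Suc_conv split: if_splits)
next
  case (4 n k)
  show ?case
    unfolding bls.simps set_append set_map 4 by (auto simp: length_Suc_conv split: if_splits)
qed auto

lemma mon_list_image: "mon_list ` mons5 n = {l. length l = 5 \<and> sum_list l = n}"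
proof (intro equalityI subsetI)
  fix l :: "nat list" assume l: "l \<in> {l. length l = 5 \<and> sum_list l = n}"
  define a where "a = (\<lambda>i. if i < 5 then l ! i else 0)"
  have "mon_list a = l"
    using l by (intro nth_equalityI) (auto simp: length_mon_list nth_mon_list a_def)
  moreover from this have "a \<in> mons5 n"
    using l sum_list_mon_list[of a] by (simp add: mons5_def) (simp add: a_def)
  ultimately show "l \<in> mon_list ` mons5 n"
    by blast
qed (auto simp: length_mon_list sum_list_mon_list mons5_def)

lemma set_mons3: "set mons3 = mon_list ` mons5 3"
  by (simp add: mons3_def set_comps mon_list_image)

lemma card_set_bits: "S \<subseteq> {..<5} \<Longrightarrow> count_list (set_bits S) False = card S"
proof -
  assume "S \<subseteq> {..<5}"
  then have "{i. i < 5 \<and> \<not> set_bits S ! i} = S"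
    by (auto simp: set_bits_def)
  then show ?thesis
    by (simp add: count_list_eq_length_filter length_filter_conv_card length_set_bits)
qed

lemma set_bits_image: "set (bls 5 k) = set_bits ` {S. S \<subseteq> {..<5} \<and> card S = k}"
proof (intro equalityI subsetI)
  fix l assume "l \<in> set (bls 5 k)"
  then have l: "length l = 5" "count_list l False = k"
    by (simp_all add: set_bls)
  define S where "S = {i. i < 5 \<and> \<not> l ! i}"
  have S: "S \<subseteq> {..<5}" and set_bits: "set_bits S = l"
    using l by (auto simp: S_def set_bits_def intro!: nth_equalityI)
  then have "card S = k"
    using card_set_bits[OF S] l by simp
  then show "l \<in> set_bits ` {S. S \<subseteq> {..<5} \<and> card S = k}"
    using S set_bits by blast
qed (auto simp: set_bls length_set_bits card_set_bits)

lemma card_mons5: "card (mons5 n) = (n + 4) choose n"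
proof -
  have "inj_on mon_list (mons5 n)"
  proof (rule inj_onI)
    fix a b assume ab: "a \<in> mons5 n" "b \<in> mons5 n" "mon_list a = mon_list b"
    then have "var_path {} a = var_path {} b"
      by (simp add: var_path_def)
    then show "a = b"
      using var_path_inject[OF ab(1,2)] by blast
  qed
  then have "card (mons5 n) = card (mon_list ` mons5 n)"
    by (simp add: card_image)
  also have "\<dots> = (n + 5 - 1) choose n"
    unfolding mon_list_image by (rule card_length_sum_list)
  finally show ?thesis
    by (simp add: add.commute)
qed

text \<open>A common form for \<open>set_systems s\<close> and for a single functional in
  \<open>Ker 4\<close>, the latter with \<open>{{}}\<close> as index family and no
  contraction.\<close>

definition systems :: "nat set set \<Rightarrow> nat set set \<Rightarrow> (nat set \<Rightarrow> poly) set" where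
  "systems \<S> \<T> = {\<Theta>. (\<forall>S. S \<notin> \<S> \<longrightarrow> \<Theta> S = 0) \<and> (\<forall>S\<in>\<S>. \<Theta> S \<in> Ker 4) \<and>
    (\<forall>T\<in>\<T>. contract (\<lambda>j. \<Theta> (insert j T)))}"

lemma contract_P5:
  assumes "\<And>j. j < 5 \<Longrightarrow> \<psi> j \<in> P5 (Suc n)"
  shows "contract \<psi> \<longleftrightarrow> (\<forall>v\<in>mons5 n. (\<Sum>j<5. \<psi> j (v + ind {j})) = 0)"
proof
  assume "contract \<psi>"
  then show "\<forall>v\<in>mons5 n. (\<Sum>j<5. \<psi> j (v + ind {j})) = 0"
    by (simp add: contract_def mons5_def)
next
  assume r: "\<forall>v\<in>mons5 n. (\<Sum>j<5. \<psi> j (v + ind {j})) = 0"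
  show "contract \<psi>"
    unfolding contract_def
  proof (intro allI impI)
    fix v :: mon assume v: "\<forall>i\<ge>5. v i = 0"
    show "(\<Sum>j<5. \<psi> j (v + ind {j})) = 0"
    proof (cases "v \<in> mons5 n")
      case False
      have "\<psi> j (v + ind {j}) = 0" if j: "j < 5" for j
      proof -
        have "(\<Sum>i<5. (v + ind {j}) i) = (\<Sum>i<5. v i) + 1"
          using ind_mons5[OF j] by (simp add: sum.distrib mons5_def)
        then have "v + ind {j} \<notin> mons5 (Suc n)"
          using False v by (simp add: mons5_def)
        then show ?thesis
          using assms[OF j] by (auto simp: P5_def)
      qed
      then show ?thesis
        by simp
    qed (use r in blast)
  qed
qed

text \<open>The unknowns are the pairs of a set in \<S> and one of the 70 monomials of degree 4,
  named injectively by paths. Solutions of the rows supported on these paths correspond to families,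
  so \<open>k\<close> independent equations leave 2^(70 card \<S> - k) of them.\<close>

lemma card_systems:
  assumes \<S>: "\<S> \<subseteq> Pow {..<5}" and \<T>: "\<And>T i. T \<in> \<T> \<Longrightarrow> i < 5 \<Longrightarrow> insert i T \<in> \<S>"
    and rs: "set rs = (\<Union>S\<in>\<S>. (\<lambda>a. ker_row (set_bits S) (mon_list a)) ` mons5 3) \<union>
      (\<Union>T\<in>\<T>. (\<lambda>a. contract_row (set_bits T) (mon_list a)) ` mons5 3)"
    and k: "map_option fst (foldl (ins n) (Some (0, TLf)) rs) = Some k"
  shows "card (systems \<S> \<T>) * 2 ^ k = 2 ^ (70 * card \<S>)"
proof -
  let ?D = "\<S> \<times> mons5 4"
  let ?p = "\<lambda>(S, m). var_path S m"
  define V where "V = ?p ` ?D"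
  have finS: "finite \<S>"
    using \<S> by (rule finite_subset) simp
  have inj: "inj_on ?p ?D"
  proof (rule inj_onI)
    fix x y assume xy: "x \<in> ?D" "y \<in> ?D" "?p x = ?p y"
    obtain S m S' m' where x: "x = (S, m)" and y: "y = (S', m')"
      by (cases x; cases y) blast
    have "S = S' \<and> m = m'"
      by (rule var_path_inject[of m 4 m']) (use xy \<S> in \<open>auto simp: x y\<close>)
    then show "x = y"
      by (simp add: x y)
  qed
  have finV: "finite V"
    unfolding V_def using finS finite_mons5 by simp
  have "card (mons5 4) = 70"
    unfolding card_mons5 by (simp add: eval_nat_numeral)
  then have cardV: "card V = 70 * card \<S>"
    unfolding V_def by (simp add: card_image[OF inj] card_cartesian_product)
  have V: "var_path S m \<in> V" if "S \<in> \<S>" "m \<in> mons5 4" for S m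
    using that unfolding V_def by force
  have four: "a + ind {i} \<in> mons5 4" if "a \<in> mons5 3" "i < 5" for a i
    using mons5_add_ind[OF that] by simp
  define \<Theta> where "\<Theta> f S m = (if S \<in> \<S> \<and> m \<in> mons5 4 then f (var_path S m) else 0)"
    for f :: "bool list \<Rightarrow> bit" and S m
  have \<Theta>P5: "\<Theta> f S \<in> P5 4" for f S
    by (auto simp: \<Theta>_def P5_def)
  have sys: "\<Theta> f \<in> systems \<S> \<T> \<longleftrightarrow> (\<forall>r\<in>set rs. ev f r = 0)" for f
  proof -
    have 0: "\<Theta> f S = 0" if "S \<notin> \<S>" for S
      using that by (simp add: \<Theta>_def fun_eq_iff)
    have 1: "\<Theta> f S \<in> Ker 4 \<longleftrightarrow> (\<forall>a\<in>mons5 3. ev f (ker_row (set_bits S) (mon_list a)) = 0)"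
      if "S \<in> \<S>" for S
      unfolding Ker_4[OF \<Theta>P5] ev_ker_row using that four
      by (intro ball_cong refl arg_cong[of _ _ "\<lambda>x. x = 0"] sum.cong) (auto simp: \<Theta>_def)
    have 2: "contract (\<lambda>j. \<Theta> f (insert j T)) \<longleftrightarrow>
        (\<forall>a\<in>mons5 3. ev f (contract_row (set_bits T) (mon_list a)) = 0)" if "T \<in> \<T>" for T
    proof -
      have "contract (\<lambda>j. \<Theta> f (insert j T)) \<longleftrightarrow>
        (\<forall>a\<in>mons5 3. (\<Sum>j<5. \<Theta> f (insert j T) (a + ind {j})) = 0)"
        using \<Theta>P5 by (intro contract_P5) simp
      also have "\<dots> \<longleftrightarrow> (\<forall>a\<in>mons5 3. ev f (contract_row (set_bits T) (mon_list a)) = 0)"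
        unfolding ev_contract_row using \<T>[OF that] four
        by (intro ball_cong refl arg_cong[of _ _ "\<lambda>x. x = 0"] sum.cong) (auto simp: \<Theta>_def)
      finally show ?thesis .
    qed
    have "(\<forall>r\<in>set rs. ev f r = 0) \<longleftrightarrow>
      (\<forall>S\<in>\<S>. \<forall>a\<in>mons5 3. ev f (ker_row (set_bits S) (mon_list a)) = 0) \<and>
      (\<forall>T\<in>\<T>. \<forall>a\<in>mons5 3. ev f (contract_row (set_bits T) (mon_list a)) = 0)"
      unfolding rs by blast
    also have "\<dots> \<longleftrightarrow> (\<forall>S\<in>\<S>. \<Theta> f S \<in> Ker 4) \<and> (\<forall>T\<in>\<T>. contract (\<lambda>j. \<Theta> f (insert j T)))"
      by (simp only: 1 2 cong: ball_cong)
    also have "\<dots> \<longleftrightarrow> \<Theta> f \<in> systems \<S> \<T>"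
      unfolding systems_def using 0 by simp
    finally show ?thesis
      by (rule sym)
  qed
  let ?sol = "{f \<in> supp_in V. \<forall>r\<in>set rs. ev f r = 0}"
  have "bij_betw \<Theta> ?sol (systems \<S> \<T>)"
    unfolding bij_betw_def
  proof (intro conjI equalityI subsetI)
    show "inj_on \<Theta> ?sol"
    proof (rule inj_onI)
      fix f g assume f: "f \<in> ?sol" and g: "g \<in> ?sol" and eq: "\<Theta> f = \<Theta> g"
      show "f = g"
      proof
        fix x
        show "f x = g x"
        proof (cases "x \<in> V")
          case True
          then obtain S m where x: "x = var_path S m" "S \<in> \<S>" "m \<in> mons5 4"
            unfolding V_def by auto
          then show ?thesis
            using fun_cong[OF fun_cong[OF eq, of S], of m] by (simp add: \<Theta>_def)
        next
          case False
          have "f x = 0" "g x = 0"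
            using False f g unfolding supp_in_def by blast+
          then show ?thesis
            by simp
        qed
      qed
    qed
  next
    fix \<theta> assume "\<theta> \<in> \<Theta> ` ?sol"
    then show "\<theta> \<in> systems \<S> \<T>"
      using sys by blast
  next
    fix \<theta> assume \<theta>: "\<theta> \<in> systems \<S> \<T>"
    define f where "f x = (if x \<in> V then (case inv_into ?D ?p x of (S, m) \<Rightarrow> \<theta> S m) else 0)" for x
    have f: "f (var_path S m) = \<theta> S m" if "S \<in> \<S>" "m \<in> mons5 4" for S m
    proof -
      have "inv_into ?D ?p (?p (S, m)) = (S, m)"
        using that by (intro inv_into_f_f[OF inj]) simp
      then show ?thesis
        using V[OF that] by (simp add: f_def)
    qed
    have "\<Theta> f S m = \<theta> S m" for S m
    proof (cases "S \<in> \<S> \<and> m \<in> mons5 4")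
      case True
      then show ?thesis
        using f by (simp add: \<Theta>_def)
    next
      case False
      have "\<theta> S m = 0"
      proof (cases "S \<in> \<S>")
        case True
        then have "\<theta> S \<in> P5 4" "m \<notin> mons5 4"
          using \<theta> False Ker_P5 by (auto simp: systems_def)
        then show ?thesis
          unfolding P5_def by blast
      next
        case False
        then have "\<theta> S = 0"
          using \<theta> by (simp add: systems_def)
        then show ?thesis
          by simp
      qed
      then show ?thesis
        unfolding \<Theta>_def if_not_P[OF False] by simp
    qed
    then have eq: "\<Theta> f = \<theta>"
      by (intro ext)
    moreover have "f \<in> supp_in V"
      by (auto simp: supp_in_def f_def split: if_splits)
    ultimately show "\<theta> \<in> \<Theta> ` ?sol"
      using sys[of f] \<theta> by blast
  qed
  then have card_eq: "card ?sol = card (systems \<S> \<T>)"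
    by (rule bij_betw_same_card)
  obtain B where B: "foldl (ins n) (Some (0, TLf)) rs = Some (k, B)"
    using k by auto
  have "nf r \<and> vars r \<subseteq> V" if r: "r \<in> set rs" for r
  proof -
    consider S a where "r = ker_row (set_bits S) (mon_list a)" "S \<in> \<S>" "a \<in> mons5 3"
      | T a where "r = contract_row (set_bits T) (mon_list a)" "T \<in> \<T>" "a \<in> mons5 3"
      using r unfolding rs by blast
    then show ?thesis
    proof cases
      case 1
      then show ?thesis
        using vars_ker_row[of S a] V four by (auto simp: nf_ker_row)
    next
      case 2
      then show ?thesis
        using vars_contract_row[of T a] V four \<T> by (auto simp: nf_contract_row)
    qed
  qed
  then have "reaches V ({} \<union> set rs) k B"
    by (rule reaches_foldl[OF reaches_empty _ B])
  then have "card ?sol * 2 ^ k = 2 ^ card V"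
    using card_reaches[OF _ finV, of "set rs"] by simp
  then show ?thesis
    by (simp only: card_eq cardV)
qed

section \<open>The staged system and its ranks\<close>

lemma set_stage:
  "set (stage t) = (\<Union>S\<in>{S. S \<subseteq> {..<5} \<and> card S = Suc t}. (\<lambda>a. ker_row (set_bits S) (mon_list a)) ` mons5 3) \<union>
    (\<Union>T\<in>{T. T \<subseteq> {..<5} \<and> card T = t}. (\<lambda>a. contract_row (set_bits T) (mon_list a)) ` mons5 3)"
  by (simp add: stage_def set_bits_image set_mons3 image_image)

definition stages :: "nat \<Rightarrow> trie list" where
  "stages s = concat (map stage [0..<s])"

lemma set_stages:
  "set (stages s) = (\<Union>S\<in>subs s. (\<lambda>a. ker_row (set_bits S) (mon_list a)) ` mons5 3) \<union>
    (\<Union>T\<in>{T. T \<subseteq> {..<5} \<and> card T < s}. (\<lambda>a. contract_row (set_bits T) (mon_list a)) ` mons5 3)"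
proof -
  have S: "(\<Union>t\<in>{0..<s}. {S. S \<subseteq> {..<5} \<and> card S = Suc t}) = subs s"
  proof (intro equalityI subsetI)
    fix S assume S: "S \<in> subs s"
    then have "card S \<noteq> 0"
      using finite_subset5[of S] by (auto simp: subs_def)
    then obtain t where "card S = Suc t"
      by (cases "card S") auto
    then show "S \<in> (\<Union>t\<in>{0..<s}. {S. S \<subseteq> {..<5} \<and> card S = Suc t})"
      using S by (auto simp: subs_def)
  qed (auto simp: subs_def)
  have T: "(\<Union>t\<in>{0..<s}. {T. T \<subseteq> {..<5::nat} \<and> card T = t}) = {T. T \<subseteq> {..<5} \<and> card T < s}"
    by auto
  have "set (stages s) = (\<Union>t\<in>{0..<s}. set (stage t))"
    by (simp add: stages_def)
  then show ?thesis
    by (simp only: set_stage UN_Un_distrib UN_UN_flatten S[symmetric] T[symmetric])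
qed

lemma card_subs: "card (subs s) = (\<Sum>k=1..s. 5 choose k)"
proof -
  have "subs s = (\<Union>k\<in>{1..s}. {S. S \<subseteq> {..<5} \<and> card S = k})"
    using finite_subset5 by (auto simp: subs_def Suc_le_eq card_gt_0_iff)
  then have "card (subs s) = (\<Sum>k=1..s. card {S. S \<subseteq> {..<5::nat} \<and> card S = k})"
    by (auto intro!: card_UN_disjoint)
  then show ?thesis
    by (simp add: n_subsets)
qed

lemma set_systems_eq: "set_systems s = systems (subs s) {T. T \<subseteq> {..<5} \<and> card T < s}"
  by (auto simp: set_systems_def systems_def)

text \<open>Sets of variables have at most five elements. The bound is 6 and not 5 because the
  strict inequality in the contraction condition has to admit the full set.\<close>

lemma set_systems_6:
  assumes "6 \<le> s"
  shows "set_systems s = set_systems 6"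
proof -
  have "S \<subseteq> {..<5} \<Longrightarrow> card S < s \<and> card S \<le> s \<and> card S < 6 \<and> card S \<le> 6" for S :: "nat set"
    using card_subset5[of S] assms by auto
  then have "subs s = subs 6" "{T. T \<subseteq> {..<5::nat} \<and> card T < s} = {T. T \<subseteq> {..<5} \<and> card T < 6}"
    unfolding subs_def by blast+
  then show ?thesis
    unfolding set_systems_eq by simp
qed

lemma power_2_cancel:
  assumes "c * 2 ^ k = (2::nat) ^ (e + k)"
  shows "c = 2 ^ e"
  using assms by (simp add: power_add)

lemma card_set_systems:
  assumes "map_option fst (foldl (ins n) (Some (0, TLf)) (stages s)) = Some k"
    and "70 * card (subs s) = e + k"
  shows "card (set_systems s) = 2 ^ e"
proof (rule power_2_cancel)
  have "card (systems (subs s) {T. T \<subseteq> {..<5} \<and> card T < s}) * 2 ^ k = 2 ^ (70 * card (subs s))"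
  proof (rule card_systems[OF _ _ set_stages assms(1)])
    show "subs s \<subseteq> Pow {..<5}"
      by (auto simp: subs_def)
    show "insert i T \<in> subs s" if "T \<in> {T. T \<subseteq> {..<5} \<and> card T < s}" "i < 5" for T i
      using that card_insert_le_m1[of s T i] card_insert_if[of T i] finite_subset5[of T]
      by (auto simp: subs_def)
  qed
  then show "card (set_systems s) * 2 ^ k = 2 ^ (e + k)"
    unfolding set_systems_eq assms(2) .
qed

text \<open>Entry s - 1 is the rank for \<open>s\<close>. That no entry is \<open>None\<close> shows
  that 80 reduction steps suffice for every row. The last stage consists of the contraction at the
  full set alone, and the rank stays 1519.\<close>

lemma counts_stages:
  "counts 80 (Some (0, TLf)) [stage 0, stage 1, stage 2, stage 3, stage 4, stage 5] =
    [Some 160, Some 570, Some 1100, Some 1449, Some 1519, Some 1519]"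
  by code_simp

text \<open>Five entries \<open>True\<close> encode the empty set, which here indexes the single
  functional of degree 4; its space has dimension 70 - 25 = 45.\<close>

lemma count_ker_row:
  "map_option fst (foldl (ins 80) (Some (0, TLf))
    (map (ker_row [True, True, True, True, True]) mons3)) = Some 25"
  by code_simp

lemma card_Ker_4: "card (Ker 4) = 2 ^ 45"
proof (rule power_2_cancel)
  have set_bits: "set_bits {} = [True, True, True, True, True]"
    by (simp add: set_bits_def upt_rec)
  have "card (systems {{}} {}) * 2 ^ 25 = 2 ^ (70 * card {{} :: nat set})"
    by (rule card_systems[OF _ _ _ count_ker_row]) (simp_all add: set_bits[symmetric] set_mons3 image_image)
  moreover have bij: "bij_betw (\<lambda>\<Theta>. \<Theta> {}) (systems {{}} {}) (Ker 4)"
  proof (rule bij_betwI')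
    fix \<Theta> \<Theta>' assume "\<Theta> \<in> systems {{}} {}" "\<Theta>' \<in> systems {{}} {}"
    then have ne: "\<Theta> S = \<Theta>' S" if "S \<noteq> {}" for S
      using that by (simp add: systems_def)
    show "\<Theta> {} = \<Theta>' {} \<longleftrightarrow> \<Theta> = \<Theta>'"
    proof
      assume "\<Theta> {} = \<Theta>' {}"
      then have "\<Theta> S = \<Theta>' S" for S
        using ne[of S] by (cases "S = {}") simp_all
      then show "\<Theta> = \<Theta>'"
        by (rule ext)
    qed simp
  next
    fix \<phi> assume "\<phi> \<in> Ker 4"
    then show "\<exists>\<Theta>\<in>systems {{}} {}. \<phi> = \<Theta> {}"
      by (intro bexI[of _ "\<lambda>S. if S = {} then \<phi> else 0"]) (simp_all add: systems_def)
  qed (simp add: systems_def)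
  ultimately show "card (Ker 4) * 2 ^ 25 = 2 ^ (45 + 25)"
    using bij_betw_same_card[OF bij] by simp
qed

theorem theorem3p9:
  fixes d :: nat
  assumes "d \<ge> 1"
  shows "dimQP5 (4 * (2 ^ d - 1)) =
           (if d = 1 then 45 else if d = 2 then 190 else if d = 3 then 480
            else if d = 4 then 650 else 651)"
proof -
  have count: "map_option fst (foldl (ins 80) (Some (0, TLf)) (stages s)) =
      [Some 160, Some 570, Some 1100, Some 1449, Some 1519, Some 1519] ! (s - 1)"
    if s: "s \<in> {1..6}" for s
  proof -
    let ?l = "[stage 0, stage 1, stage 2, stage 3, stage 4, stage 5]"
    have "?l = map stage [0..<6]"
      by (simp add: upt_rec eval_nat_numeral)
    moreover have "take (Suc (s - 1)) (map stage [0..<6]) = map stage [0..<s]"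
      using s by (simp add: take_map take_upt)
    ultimately have "concat (take (Suc (s - 1)) ?l) = stages s"
      by (simp only: stages_def)
    moreover have "s - 1 < length ?l"
      using s by auto
    note counts_nth[OF this, of 80 "Some (0, TLf)"]
    ultimately show ?thesis
      by (simp only: counts_stages)
  qed
  have card: "card (set_systems s) = 2 ^ (if s = 1 then 190 else if s = 2 then 480
      else if s = 3 then 650 else 651)" if s: "s \<in> {1..6}" for s
  proof (rule card_set_systems)
    \<comment> \<open>The sets number 5, 15, 25, 30, 31 and 31 for s = 1, ..., 6; subtracting these
      ranks from 70 times that number leaves the dimensions.\<close>
    let ?k = "if s = 1 then 160 else if s = 2 then 570 else if s = 3 then 1100
      else if s = 4 then 1449 else 1519 :: nat"
    have cases: "s = 1 \<or> s = 2 \<or> s = 3 \<or> s = 4 \<or> s = 5 \<or> s = 6"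
      using s by auto
    show "map_option fst (foldl (ins 80) (Some (0, TLf)) (stages s)) = Some ?k"
      unfolding count[OF s] using cases by auto
    show "70 * card (subs s) = (if s = 1 then 190 else if s = 2 then 480
      else if s = 3 then 650 else 651) + ?k"
      unfolding card_subs using cases
      by (elim disjE) (simp_all add: eval_nat_numeral sum.atLeast_Suc_atMost)
  qed
  consider "d = 1" | s where "d = Suc s" "0 < s"
    using assms by (cases d) auto
  then show ?thesis
  proof cases
    case 1
    then show ?thesis
      using dimQP5_eq[OF card_Ker_4] by simp
  next
    case 2
    \<comment> \<open>From s = 6 on the system no longer changes, so the six computed ranks cover
      every d = s + 1.\<close>
    define r where "r = min s 6"
    have "card (Ker (deg d)) = card (set_systems r)"
      using card_Ker_deg[OF 2(2)] set_systems_6[of s] 2(1) by (simp add: r_def min_def)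
    also have "\<dots> = 2 ^ (if r = 1 then 190 else if r = 2 then 480 else if r = 3 then 650 else 651)"
      using 2 by (intro card) (simp add: r_def)
    finally have "dimQP5 (deg d) =
        (if r = 1 then 190 else if r = 2 then 480 else if r = 3 then 650 else 651)"
      by (rule dimQP5_eq)
    then show ?thesis
      using 2 by (auto simp: deg_def r_def)
  qed
qed

end
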